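(* Let $k,t$ be integers with $k=t^2\ge 9$, and let $H$ be a subgraph of the star $K_{1,\lceil (k-2)/2\rceil}$ with $|E(H)|\ge 3$. Then $$\operatorname{bi-GM}_{k-1}(P_5:H)=t^2(t-1)^2(t-2)-3(t-1)(t-2).$$
   Context: All graphs are finite, simple and without isolated vertices. $P_n$ is the path on $n$ vertices; $K_{m,n}$ is the complete bipartite graph. A $k$-edge-coloring of a graph is a map from its edge set onto $\{1,\dots,k\}$ that is exact, i.e. every one of the $k$ colors is used at least once. An edge-colored graph is rainbow if all its edges have distinct colors and monochromatic if all its edges have the same color. A copy of a graph $F$ in a graph $G$ is a subgraph of $G$ isomorphic to $F$; distinct copies are distinct subgraphs. For non-empty bipartite graphs $G,H$ and a positive integer $k$, the bipartite Gallai-Ramsey number $\operatorname{bgr}_k(G:H)$ is the minimum integer $N$ such that for all $n\ge N$, every (exact) $k$-edge-coloring of $K_{n,n}$ contains a rainbow copy of $G$ or a monochromatic copy of $H$. The bipartite Gallai-Ramsey multiplicity $\operatorname{bi-GM}_k(G:H)$ is the minimum, over all (exact) $k$-edge-colorings of $K_{N,N}$ with $N=\operatorname{bgr}_k(G:H)$, of the total number of rainbow copies of $G$ plus monochromatic copies of $H$.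
   Formalization: Here t is the positive root of k (for negative t the right side is negative), and the minimum defining bgr_k ranges over N with N² ≥ k, since for smaller N no exact k-coloring of K_{N,N} exists and the multiplicity would be a minimum over the empty set. *)

theory Defs
  imports Complex_Main
begin

text \<open>A graph is a pair of a vertex set and a set of two-element vertex sets.
  Throughout, graphs are finite, simple and without isolated vertices.\<close>

type_synonym 'a graph = "'a set \<times> 'a set set"

abbreviation verts :: "'a graph \<Rightarrow> 'a set" where
  "verts \<equiv> fst"

abbreviation edges :: "'a graph \<Rightarrow> 'a set set" where
  "edges \<equiv> snd"

definition simple_graph :: "'a graph \<Rightarrow> bool" where
  "simple_graph G \<longleftrightarrow> finite (verts G)
     \<and> (\<forall>e \<in> edges G. e \<subseteq> verts G \<and> card e = 2)
     \<and> (\<forall>v \<in> verts G. \<exists>e \<in> edges G. v \<in> e)"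

definition subgraph :: "'a graph \<Rightarrow> 'a graph \<Rightarrow> bool" where
  "subgraph S G \<longleftrightarrow> simple_graph S \<and> verts S \<subseteq> verts G \<and> edges S \<subseteq> edges G"

definition isomorphic :: "'a graph \<Rightarrow> 'b graph \<Rightarrow> bool" where
  "isomorphic F G \<longleftrightarrow> (\<exists>f. bij_betw f (verts F) (verts G)
     \<and> (\<forall>u \<in> verts F. \<forall>v \<in> verts F. {u, v} \<in> edges F \<longleftrightarrow> {f u, f v} \<in> edges G))"

definition copies :: "'a graph \<Rightarrow> 'b graph \<Rightarrow> 'b graph set" where
  "copies F G = {S. subgraph S G \<and> isomorphic F S}"

definition path_graph :: "nat \<Rightarrow> nat graph" where
  "path_graph n = ({..<n}, {{i, Suc i} | i. Suc i < n})"

definition complete_bipartite :: "nat \<Rightarrow> nat \<Rightarrow> (nat + nat) graph" where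
  "complete_bipartite m n =
     ({..<m} <+> {..<n}, {{Inl i, Inr j} | i j. i < m \<and> j < n})"

text \<open>Only the values of a coloring on the edges of the graph are relevant.\<close>

definition exact_coloring :: "nat \<Rightarrow> 'a graph \<Rightarrow> ('a set \<Rightarrow> nat) \<Rightarrow> bool" where
  "exact_coloring k G c \<longleftrightarrow> c ` edges G = {1..k}"

definition rainbow :: "('a set \<Rightarrow> nat) \<Rightarrow> 'a graph \<Rightarrow> bool" where
  "rainbow c S \<longleftrightarrow> inj_on c (edges S)"

definition monochromatic :: "('a set \<Rightarrow> nat) \<Rightarrow> 'a graph \<Rightarrow> bool" where
  "monochromatic c S \<longleftrightarrow> (\<forall>e \<in> edges S. \<forall>e' \<in> edges S. c e = c e')"

definition rainbow_copies :: "('b set \<Rightarrow> nat) \<Rightarrow> 'a graph \<Rightarrow> 'b graph \<Rightarrow> 'b graph set" where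
  "rainbow_copies c F G = {S \<in> copies F G. rainbow c S}"

definition mono_copies :: "('b set \<Rightarrow> nat) \<Rightarrow> 'a graph \<Rightarrow> 'b graph \<Rightarrow> 'b graph set" where
  "mono_copies c F G = {S \<in> copies F G. monochromatic c S}"

text \<open>The graph \<open>K\<^sub>n\<^sub>,\<^sub>n\<close> has \<open>n\<^sup>2\<close> edges, so it has an exact \<open>k\<close>-edge-coloring
  (\<open>k \<ge> 1\<close>) iff \<open>k \<le> n\<^sup>2\<close>.  The minimum defining the bipartite Gallai-Ramsey number
  is taken over the \<open>N\<close> with \<open>k \<le> N\<^sup>2\<close>: smaller \<open>n\<close> would satisfy the coloring
  condition vacuously, and the multiplicity below would be a minimum over the empty set.\<close>

definition bgr :: "nat \<Rightarrow> 'a graph \<Rightarrow> 'b graph \<Rightarrow> nat" where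
  "bgr k G H = (LEAST N. k \<le> N\<^sup>2 \<and>
     (\<forall>n \<ge> N. \<forall>c. exact_coloring k (complete_bipartite n n) c \<longrightarrow>
        rainbow_copies c G (complete_bipartite n n) \<noteq> {} \<or>
        mono_copies c H (complete_bipartite n n) \<noteq> {}))"

definition bi_GM :: "nat \<Rightarrow> 'a graph \<Rightarrow> 'b graph \<Rightarrow> nat" where
  "bi_GM k G H =
     (let K = complete_bipartite (bgr k G H) (bgr k G H)
      in LEAST m. \<exists>c. exact_coloring k K c \<and>
           m = card (rainbow_copies c G K) + card (mono_copies c H K))"

end

theory Submission
  imports Defs
begin

text \<open>Let a coloring of \<open>K\<^sub>n\<^sub>,\<^sub>n\<close> with \<open>q \<ge> 8\<close> colors have no rainbow \<open>P\<^sub>5\<close>. If some vertex sees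
  only one color, then \<open>q \<le> 2 n\<close> and that vertex is the center of a large monochromatic star.
  Otherwise every vertex sees exactly two colors, and since the color pairs at the two ends of
  an edge meet, one color occurs at every vertex; again there is a star with at least
  \<open>(q - 1) / 2\<close> edges of one color. Hence the bipartite Gallai-Ramsey number for \<open>q = t\<^sup>2 - 1\<close>
  is the smallest possible value \<open>t\<close>. In \<open>K\<^sub>t\<^sub>,\<^sub>t\<close> such a coloring repeats exactly one color, on
  exactly two edges, so there is no monochromatic \<open>H\<close>, and a \<open>P\<^sub>5\<close> is rainbow unless it contains
  both of these edges. The number of \<open>P\<^sub>5\<close> through two given edges is \<open>3 (t - 1) (t - 2)\<close> if they
  are adjacent and at most \<open>6 (t - 2)\<close> otherwise.\<close>

section \<open>Colorings without rainbow paths on five vertices\<close>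

lemma card_2_eq_doubleton:
  assumes "card A = 2" "a \<in> A" "b \<in> A" "a \<noteq> b"
  shows "A = {a, b}"
  using assms by (metis card_2_iff doubleton_eq_iff insertE singletonD)

text \<open>\<open>g u v\<close> stands for the color of the edge between left vertex
  \<open>u\<close> and right vertex \<open>v\<close>. The two path axioms cover the paths with three
  vertices on the left and on the right. Both sides share the index set \<open>I\<close>, which
  makes the setting symmetric under transposition.\<close>

locale rainbow_P5_free =
  fixes I :: "'v set" and g :: "'v \<Rightarrow> 'v \<Rightarrow> 'c"
  assumes finite_I: "finite I"
    and row_path: "\<lbrakk>a \<in> I; b \<in> I; c \<in> I; x \<in> I; y \<in> I; a \<noteq> b; b \<noteq> c; a \<noteq> c; x \<noteq> y\<rbrakk>
      \<Longrightarrow> \<not> distinct [g a x, g b x, g b y, g c y]"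
    and col_path: "\<lbrakk>a \<in> I; b \<in> I; c \<in> I; x \<in> I; y \<in> I; a \<noteq> b; b \<noteq> c; a \<noteq> c; x \<noteq> y\<rbrakk>
      \<Longrightarrow> \<not> distinct [g x a, g x b, g y b, g y c]"
begin

definition row :: "'v \<Rightarrow> 'c set" where "row u = g u ` I"

definition col :: "'v \<Rightarrow> 'c set" where "col v = (\<lambda>u. g u v) ` I"

definition colors :: "'c set" where "colors = (\<Union>u\<in>I. row u)"

text \<open>Swapping the sides exchanges the two path axioms, so every fact about rows yields its
  counterpart for columns by instantiation.\<close>

lemma transpose: "rainbow_P5_free I (\<lambda>x y. g y x)"
  using finite_I row_path col_path by unfold_locales blast+

lemma transpose_row: "rainbow_P5_free.row I (\<lambda>x y. g y x) = col"
  by (simp add: fun_eq_iff rainbow_P5_free.row_def[OF transpose] col_def)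

lemma transpose_col: "rainbow_P5_free.col I (\<lambda>x y. g y x) = row"
  by (simp add: fun_eq_iff rainbow_P5_free.col_def[OF transpose] row_def)

lemma transpose_colors: "rainbow_P5_free.colors I (\<lambda>x y. g y x) = colors"
  by (auto simp: rainbow_P5_free.colors_def[OF transpose] transpose_row colors_def col_def row_def)

lemma row_mem: "\<lbrakk>u \<in> I; v \<in> I\<rbrakk> \<Longrightarrow> g u v \<in> row u"
  and col_mem: "\<lbrakk>u \<in> I; v \<in> I\<rbrakk> \<Longrightarrow> g u v \<in> col v"
  and finite_row: "finite (row u)"
  and finite_col: "finite (col v)"
  and finite_colors: "finite colors"
  by (auto simp: row_def col_def colors_def finite_I)

lemma obtain_row_avoiding:
  assumes "finite C" and "card C < card (row u)"
  obtains v where "v \<in> I" and "g u v \<notin> C"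
proof -
  have "\<not> row u \<subseteq> C"
    using assms by (meson card_mono leD)
  thus thesis using that by (auto simp: row_def)
qed

section \<open>Bounding the number of colors at a vertex\<close>

text \<open>With five colors, row \<open>u\<close> always offers an edge whose color avoids four
  given ones. Unless some row is constant, this spare edge forces all rows to coincide with row
  \<open>u\<close>, and then every column is constant.\<close>

lemma mono_row_or_col_if_row_large:
  assumes u: "u \<in> I" and large: "card (row u) \<ge> 5"
  shows "\<exists>z\<in>I. card (row z) \<le> 1 \<or> card (col z) \<le> 1"
proof (cases "\<exists>z\<in>I. \<exists>k. \<forall>v\<in>I. g z v = k")
  case True
  then obtain z k where z: "z \<in> I" "\<And>v. v \<in> I \<Longrightarrow> g z v = k" by blast
  have "row z \<subseteq> {k}" using z by (auto simp: row_def)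
  hence "card (row z) \<le> 1" using card_mono[of "{k}" "row z"] by simp
  thus ?thesis using z by blast
next
  case False
  have key: "g u' v = g u' w \<or> g u v = g u' v \<or> g u v = g u' w"
    if "u' \<in> I" "u' \<noteq> u" "v \<in> I" "w \<in> I" for u' v w
  proof (rule ccontr)
    assume neg: "\<not> ?thesis"
    \<comment> \<open>The aim is a rainbow path \<open>z\<close>, \<open>u\<close>,
      \<open>v\<close>, \<open>u'\<close>, \<open>w\<close>. Listing \<open>g u w\<close> keeps the
      new end \<open>z\<close> different from \<open>w\<close>.\<close>
    have "card {g u v, g u' v, g u' w, g u w} < card (row u)"
      using large card_length[of "[g u v, g u' v, g u' w, g u w]"] by simp
    then obtain z where z: "z \<in> I" "g u z \<notin> {g u v, g u' v, g u' w, g u w}"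
      by (meson finite.emptyI finite.insertI obtain_row_avoiding)
    have "z \<noteq> v" "z \<noteq> w" "v \<noteq> w" using z neg by auto
    thus False using col_path[of z v w u u'] z neg that u by auto
  qed
  have same: "g u' v = g u v" if u': "u' \<in> I" "u' \<noteq> u" and v: "v \<in> I" for u' v
  proof (rule ccontr)
    assume ne: "g u' v \<noteq> g u v"
    have two: "g u' w = g u' v \<or> g u' w = g u v" if "w \<in> I" for w
      using key[OF u' v that] ne by auto
    from False u' obtain w where w: "w \<in> I" "g u' w \<noteq> g u' v" by metis
    \<comment> \<open>In row \<open>u'\<close> the columns \<open>v\<close> and \<open>w\<close>
      have different colors; \<open>key\<close> is used for \<open>w'\<close> and the one of the two
      whose color there differs from that of \<open>w'\<close>.\<close>
    have "g u w' \<in> {g u' v, g u v}" if w': "w' \<in> I" for w'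
      using key[OF u' w' v] key[OF u' w' w(1)] two[OF w'] two[OF w(1)] w ne by auto
    hence "row u \<subseteq> {g u' v, g u v}" by (auto simp: row_def)
    hence "card (row u) \<le> 2"
      using card_mono[of "{g u' v, g u v}" "row u"] card_length[of "[g u' v, g u v]"] by simp
    thus False using large by simp
  qed
  have "col u \<subseteq> {g u u}" using same u by (auto simp: col_def)
  hence "card (col u) \<le> 1" using card_mono[of "{g u u}" "col u"] by simp
  thus ?thesis using u by blast
qed

text \<open>If row \<open>u\<close> had three colors, a set \<open>M\<close> of at least four colors
  would be missing from it. Edges colored from \<open>M\<close> extend to paths through
  \<open>u\<close>; that these are not rainbow restricts the coloring until some row has a single
  color \<open>r\<close>.\<close>

lemma row_le_2:
  assumes many: "card colors \<ge> 8"
    and nonmono: "\<And>z. z \<in> I \<Longrightarrow> 2 \<le> card (row z) \<and> 2 \<le> card (col z)"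
    and small: "\<And>z. z \<in> I \<Longrightarrow> card (row z) \<le> 4 \<and> card (col z) \<le> 4"
    and u: "u \<in> I"
  shows "card (row u) \<le> 2"
proof (rule ccontr)
  assume "\<not> ?thesis"
  hence three: "card (row u) \<ge> 3" by simp
  define M where "M = colors - row u"
  have "card M = card colors - card (row u)"
    unfolding M_def by (rule card_Diff_subset) (use u finite_row in \<open>auto simp: colors_def\<close>)
  hence cardM: "card M \<ge> 4" using many small[OF u] by linarith
  have finM: "finite M" unfolding M_def using finite_colors by simp
  have M_neq_u: "u' \<noteq> u" if "g u' w \<in> M" "w \<in> I" for u' w
    using that row_mem[of u w] u by (auto simp: M_def)
  have M_at: "\<exists>u'\<in>I. \<exists>w\<in>I. g u' w = m" if "m \<in> M" for m
    using that by (auto simp: M_def colors_def row_def)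
  have M_D: "g u v \<noteq> g u' w" if "g u' w \<in> M" "v \<in> I" for v u' w
    using that row_mem[of u v] u by (auto simp: M_def)
  have no_row_M: "\<not> M \<subseteq> row u'" if u': "u' \<in> I" for u'
  proof
    assume sub: "M \<subseteq> row u'"
    have eq: "row u' = M"
      using card_seteq[OF finite_row sub] cardM small[OF u'] by (metis le_trans)
    have uu': "u' \<noteq> u" using eq row_mem[OF u u] by (auto simp: M_def)
    \<comment> \<open>Rows \<open>u\<close> and \<open>u'\<close> now have no color in common, so
      \<open>z\<close>, \<open>u\<close>, \<open>v\<close>, \<open>u'\<close>, \<open>u\<close>
      becomes a rainbow path; its last vertex is the right vertex that happens to have the index
      \<open>u\<close>.\<close>
    have "card {g u' u} < card (row u')" using nonmono[OF u'] by simp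
    then obtain v where v: "v \<in> I" "g u' v \<notin> {g u' u}"
      by (meson finite.emptyI finite.insertI obtain_row_avoiding)
    have "card {g u v, g u u} < card (row u)"
      using three card_length[of "[g u v, g u u]"] by simp
    then obtain z where z: "z \<in> I" "g u z \<notin> {g u v, g u u}"
      by (meson finite.emptyI finite.insertI obtain_row_avoiding)
    have inM: "g u' v \<in> M" "g u' u \<in> M" using eq row_mem u' v u by auto
    show False
      using col_path[of z v u u u'] z v u u' uu' M_D[OF inM(1)] M_D[OF inM(2)] by auto
  qed
  \<comment> \<open>On the path \<open>u'\<close>, \<open>w\<close>, \<open>u\<close>,
    \<open>v\<close>, \<open>u''\<close> the first three edges have distinct colors, so the last one
    must repeat one of them.\<close>
  have column_colors: "g u'' v \<in> {g u' w, g u w, g u v}"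
    if "u' \<in> I" "w \<in> I" "g u' w \<in> M" "v \<in> I" "g u v \<noteq> g u w" "u'' \<in> I" "u'' \<noteq> u" "u'' \<noteq> u'"
    for u' w v u''
  proof (rule ccontr)
    assume "\<not> ?thesis"
    moreover have "w \<noteq> v" using that by auto
    ultimately show False
      using row_path[of u' u u'' w v] that u M_neq_u[OF that(3,2)]
        M_D[OF that(3,2)] M_D[OF that(3,4)] by auto
  qed
  have meet: "g u w = g u w' \<or> u' = u''"
    if "u' \<in> I" "w \<in> I" "u'' \<in> I" "w' \<in> I" "g u' w \<in> M" "g u'' w' \<in> M" "g u' w \<noteq> g u'' w'"
    for u' w u'' w'
    using column_colors[of u' w w' u''] that M_neq_u[OF that(6,4)] M_D[OF that(6), of w]
      M_D[OF that(6), of w'] by (metis insert_iff empty_iff)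
  text \<open>Edges with distinct colors in \<open>M\<close> are related by one of two equivalences, so one of the
    two relates all of them; it cannot be the second one, because no row contains all of \<open>M\<close>.\<close>
  have meet_all: "g u w = g u w'"
    if a: "u' \<in> I" "w \<in> I" "u'' \<in> I" "w' \<in> I" "g u' w \<in> M" "g u'' w' \<in> M" for u' w u'' w'
  proof (rule ccontr)
    assume ne: "g u w \<noteq> g u w'"
    obtain m where m: "m \<in> M" "m \<notin> row u'" using no_row_M[OF a(1)] by blast
    obtain p q where pq: "p \<in> I" "q \<in> I" "g p q = m" using M_at[OF m(1)] by blast
    obtain m' where m': "m' \<in> M" "m' \<notin> row u''" using no_row_M[OF a(3)] by blast
    obtain p' q' where pq': "p' \<in> I" "q' \<in> I" "g p' q' = m'" using M_at[OF m'(1)] by blast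
    have 1: "p \<noteq> u'" "g u' w \<noteq> m" using m pq row_mem[OF pq(1,2)] row_mem[OF a(1,2)] by auto
    have 2: "p' \<noteq> u''" "g u'' w' \<noteq> m'" using m' pq' row_mem[OF pq'(1,2)] row_mem[OF a(3,4)] by auto
    have 3: "g u q = g u w" using meet[of u' w p q] a pq m 1 by auto
    have 4: "g u q' = g u w'" using meet[of u'' w' p' q'] a pq' m' 2 by auto
    have 5: "g u' w = g u'' w' \<or> u' = u''" using meet[of u' w u'' w'] a ne by auto
    have 6: "m = g u'' w' \<or> p = u''" using meet[of p q u'' w'] a pq m 3 ne by auto
    have 7: "g u' w = m' \<or> u' = p'" using meet[of u' w p' q'] a pq' m' 4 ne by auto
    have 8: "m = m' \<or> p = p'" using meet[of p q p' q'] pq m pq' m' 3 4 ne by auto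
    have 9: "p = u'' \<Longrightarrow> m \<noteq> m'" using m' pq row_mem[OF pq(1,2)] by auto
    have 10: "u' = u'' \<Longrightarrow> m \<noteq> g u'' w'" using m row_mem[OF a(3,4)] by auto
    have 11: "u' = u'' \<Longrightarrow> m' \<noteq> g u' w" using m' row_mem[OF a(1,2)] by auto
    show False using 1 2 5 6 7 8 9 10 11 by metis
  qed
  obtain m0 where "m0 \<in> M" using cardM by fastforce
  then obtain u0 w0 where e0: "u0 \<in> I" "w0 \<in> I" "g u0 w0 \<in> M" using M_at by blast
  \<comment> \<open>By \<open>meet_all\<close>, row \<open>u\<close> has this color in every column
    that contains an edge colored from \<open>M\<close>.\<close>
  define r where "r = g u w0"
  have r: "g u w = r" if "u' \<in> I" "w \<in> I" "g u' w \<in> M" for u' w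
    using meet_all[OF that(1,2) e0(1,2) that(3) e0(3)] by (simp add: r_def)
  have rM: "r \<notin> M" using row_mem[OF u e0(2)] by (simp add: M_def r_def)
  have other_row: "\<exists>u'\<in>I. \<exists>w\<in>I. g u' w \<in> M \<and> u' \<noteq> x" if "x \<in> I" for x
    using no_row_M[OF that] M_at row_mem that by (metis subsetI)
  \<comment> \<open>A column that alone carried the colors of \<open>M\<close> would also carry
    \<open>r\<close>, hence at least five colors.\<close>
  have other_col: "\<exists>u'\<in>I. \<exists>w\<in>I. g u' w \<in> M \<and> w \<noteq> x" if x: "x \<in> I" for x
  proof (rule ccontr)
    assume "\<not> ?thesis"
    hence at: "\<exists>u'\<in>I. g u' x = m" if "m \<in> M" for m using M_at that by metis
    have "M \<subseteq> col x" using at by (force simp: col_def)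
    moreover have "r \<in> col x"
      using at \<open>m0 \<in> M\<close> r[OF _ x] col_mem[OF u x] by metis
    ultimately have "card (insert r M) \<le> card (col x)"
      by (intro card_mono finite_col) auto
    thus False using small[OF x] rM finM cardM by simp
  qed
  have col_sub: "g u' v \<in> {r, g u v}" if "u' \<in> I" "v \<in> I" "g u v \<noteq> r" for u' v
  proof (cases "u' = u")
    case False
    obtain p w where "p \<in> I" "w \<in> I" "g p w \<in> M" "p \<noteq> u'" using other_row \<open>u' \<in> I\<close> by blast
    thus ?thesis using column_colors[of p w v u'] r[of p w] r[of u' v] that False
      by (metis insert_iff empty_iff)
  qed auto
  \<comment> \<open>A row with an edge colored from \<open>M\<close> copies row \<open>u\<close>
    wherever the latter differs from \<open>r\<close>. Otherwise it has \<open>r\<close> at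
    \<open>v\<close>, and \<open>w\<close>, \<open>u'\<close>, \<open>v\<close>, \<open>u\<close>,
    \<open>z\<close> is a rainbow path.\<close>
  have agree: "g u' v = g u v"
    if a: "u' \<in> I" "w \<in> I" "g u' w \<in> M" "v \<in> I" "g u v \<noteq> r" for u' w v
  proof (rule ccontr)
    assume "g u' v \<noteq> g u v"
    hence c: "g u' v = r" using col_sub a by blast
    have "card {r, g u v} < card (row u)" using three card_length[of "[r, g u v]"] by simp
    then obtain z where z: "z \<in> I" "g u z \<notin> {r, g u v}"
      by (meson finite.emptyI finite.insertI obtain_row_avoiding)
    have "w \<noteq> v" "w \<noteq> z" "v \<noteq> z" using r[OF a(1-3)] z a by auto
    thus False
      using col_path[of w v z u' u] a z u c M_neq_u[OF a(3,2)]
        M_D[OF a(3,4)] M_D[OF a(3) z(1)] rM by auto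
  qed
  \<comment> \<open>A row \<open>p\<close> with \<open>r\<close> at a place where row
    \<open>u\<close> differs from \<open>r\<close> is confined to two colors by the path
    \<open>w\<close>, \<open>u'\<close>, \<open>v\<close>, \<open>p\<close>,
    \<open>z\<close>.\<close>
  have row_sub: "row p \<subseteq> {r, g u v}"
    if a: "p \<in> I" "v \<in> I" "g u v \<noteq> r" "g p v = r" for p v
  proof -
    have "g p z \<in> {r, g u v}" if z: "z \<in> I" for z
    proof (cases "z = v")
      case False
      obtain u' w where e: "u' \<in> I" "w \<in> I" "g u' w \<in> M" "w \<noteq> z" using other_col[OF z] by blast
      have 1: "w \<noteq> v" using r e a by auto
      have 2: "g u' v = g u v" using agree e a by blast
      hence 3: "u' \<noteq> p" using a by auto
      have 4: "g p z \<notin> M" using agree[OF a(1) z _ a(2,3)] a by auto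
      have 5: "g u v \<notin> M" using row_mem[OF u a(2)] by (simp add: M_def)
      show ?thesis
        using col_path[of w v z u' p] e a z u False 1 2 3 4 5 rM by auto
    qed (use a in simp)
    thus ?thesis by (auto simp: row_def)
  qed
  have "card {r} < card (row u)" using three by simp
  then obtain v where v: "v \<in> I" "g u v \<noteq> r"
    by (metis finite.emptyI finite.insertI obtain_row_avoiding singleton_iff)
  have "card {r, g u v} < card (row u)" using three card_length[of "[r, g u v]"] by simp
  then obtain v2 where v2: "v2 \<in> I" "g u v2 \<notin> {r, g u v}"
    by (meson finite.emptyI finite.insertI obtain_row_avoiding)
  \<comment> \<open>As column \<open>v\<close> is not constant, some row \<open>p\<close> has
    \<open>r\<close> there. Then \<open>row_sub\<close>, used at \<open>v\<close> and at
    \<open>v2\<close>, leaves \<open>r\<close> as the only color of row \<open>p\<close>.\<close>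
  have "\<not> col v \<subseteq> {g u v}"
    using nonmono[OF v(1)] card_mono[of "{g u v}" "col v"] by auto
  then obtain p where p: "p \<in> I" "g p v \<noteq> g u v" by (auto simp: col_def)
  hence "g p v = r" using col_sub v by blast
  hence 1: "row p \<subseteq> {r, g u v}" using row_sub p v by blast
  hence "g p v2 \<in> {r, g u v}" using row_mem p v2 by blast
  hence "g p v2 = r" using col_sub[OF p(1) v2(1)] v2 by auto
  hence "row p \<subseteq> {r, g u v2}" using row_sub[OF p(1) v2(1)] v2 by auto
  with 1 v2 have "row p \<subseteq> {r}" by auto
  hence "card (row p) \<le> 1" using card_mono[of "{r}"] by force
  thus False using nonmono[OF p(1)] by simp
qed

section \<open>Large monochromatic stars\<close>

definition has_mono_star :: "nat \<Rightarrow> bool" where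
  "has_mono_star s \<longleftrightarrow> (\<exists>z\<in>I. \<exists>k. s \<le> card {v \<in> I. g z v = k} \<or> s \<le> card {v \<in> I. g v z = k})"

text \<open>A column with colors \<open>a\<close> and \<open>k\<close> meets row \<open>u\<close> in
  one of these two. A row without \<open>a\<close> would therefore contain all of \<open>x\<close>,
  \<open>y\<close> and \<open>z\<close>.\<close>

lemma rows_common_color:
  assumes two: "\<And>z. z \<in> I \<Longrightarrow> card (row z) = 2 \<and> card (col z) = 2"
    and x: "x \<in> B" "y \<in> B" "z \<in> B" and ne: "x \<noteq> y" "y \<noteq> z" "x \<noteq> z" "a \<notin> {x, y, z}"
    and cols: "\<And>k. k \<in> B \<Longrightarrow> \<exists>v\<in>I. {a, k} \<subseteq> col v"
    and u: "u \<in> I"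
  shows "a \<in> row u"
proof (rule ccontr)
  assume na: "a \<notin> row u"
  have "k \<in> row u" if k: "k \<in> {x, y, z}" for k
  proof -
    have "k \<in> B" "k \<noteq> a" using k x ne by auto
    then obtain v where v: "v \<in> I" "{a, k} \<subseteq> col v" using cols by blast
    hence "col v = {a, k}" using card_2_eq_doubleton[of "col v" a k] two \<open>k \<noteq> a\<close> by auto
    thus ?thesis using col_mem[OF u v(1)] row_mem[OF u v(1)] na by auto
  qed
  hence "{x, y, z} \<subseteq> row u" by auto
  hence "card {x, y, z} \<le> card (row u)" by (rule card_mono[OF finite_row])
  thus False using two[OF u] ne by simp
qed

text \<open>Some color \<open>a\<close> occurs at every vertex. Every other color \<open>k\<close>
  has its own row with colors \<open>a\<close> and \<open>k\<close>, so there are at most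
  \<open>card I + 1\<close> colors, and any two of these rows together have color \<open>a\<close>
  in every column.\<close>

lemma star_if_all_two:
  assumes many: "card colors \<ge> 8"
    and two: "\<And>z. z \<in> I \<Longrightarrow> card (row z) = 2 \<and> card (col z) = 2"
    and s: "2 * s \<le> card colors"
  shows "has_mono_star s"
proof -
  have three: "\<exists>x y z. {x, y, z} \<subseteq> X \<and> x \<noteq> y \<and> y \<noteq> z \<and> x \<noteq> z" if "card X \<ge> 3" for X :: "'c set"
    using obtain_subset_with_card_n[OF that] card_3_iff by metis
  have "I \<noteq> {}" using many by (auto simp: colors_def)
  then obtain u0 where u0: "u0 \<in> I" by blast
  obtain a0 b0 where ab: "row u0 = {a0, b0}" using two[OF u0] by (meson card_2_iff)
  \<comment> \<open>\<open>N a\<close> collects the colors that share a column with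
    \<open>a\<close>. The column of any edge meets row \<open>u0\<close>, so every color other than
    \<open>a0\<close> and \<open>b0\<close> lies in \<open>N a0\<close> or
    \<open>N b0\<close>.\<close>
  define N where "N = (\<lambda>a. {k \<in> colors - {a}. \<exists>v\<in>I. {a, k} \<subseteq> col v})"
  have "colors \<subseteq> {a0, b0} \<union> N a0 \<union> N b0"
  proof
    fix k assume k: "k \<in> colors"
    then obtain u v where "u \<in> I" "v \<in> I" "k = g u v" by (auto simp: colors_def row_def)
    thus "k \<in> {a0, b0} \<union> N a0 \<union> N b0"
      using col_mem[of u v] col_mem[OF u0, of v] row_mem[OF u0, of v] k ab by (auto simp: N_def)
  qed
  moreover have finN: "finite (N a)" for a using finite_colors by (auto simp: N_def)
  ultimately have "card colors \<le> card ({a0, b0} \<union> N a0 \<union> N b0)"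
    by (intro card_mono) auto
  also have "\<dots> \<le> card {a0, b0} + card (N a0) + card (N b0)"
    by (meson add_le_mono1 card_Un_le le_trans)
  also have "\<dots> \<le> 2 + card (N a0) + card (N b0)" using card_length[of "[a0, b0]"] by simp
  finally have "card (N a0) \<ge> 3 \<or> card (N b0) \<ge> 3" using many by linarith
  then obtain a where Na: "card (N a) \<ge> 3" by blast
  then obtain x y z where xyz: "{x, y, z} \<subseteq> N a" "x \<noteq> y" "y \<noteq> z" "x \<noteq> z" using three by meson
  have a_row: "a \<in> row u" if "u \<in> I" for u
    by (rule rows_common_color[OF two, of x "N a" y z]) (use xyz that in \<open>auto simp: N_def\<close>)
  have "card (colors - {a}) \<ge> 3"
    using many finite_colors card_Diff_subset[of "{a}" colors] by (cases "a \<in> colors") auto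
  then obtain x y z where xyz: "{x, y, z} \<subseteq> colors - {a}" "x \<noteq> y" "y \<noteq> z" "x \<noteq> z"
    using three by meson
  have at_row: "\<exists>u\<in>I. {a, k} \<subseteq> row u" if "k \<in> colors" for k
    using that a_row by (auto simp: colors_def)
  have a_col: "a \<in> col v" if "v \<in> I" for v
    by (rule rainbow_P5_free.rows_common_color[OF transpose, unfolded transpose_row transpose_col,
          of x "colors - {a}" y z])
      (use xyz that two at_row in auto)
  have "\<exists>f. \<forall>k\<in>colors - {a}. f k \<in> I \<and> row (f k) = {a, k}"
  proof (intro bchoice ballI)
    fix k assume k: "k \<in> colors - {a}"
    then obtain u where u: "u \<in> I" "{a, k} \<subseteq> row u" using at_row by blast
    hence "row u = {a, k}" using card_2_eq_doubleton[of "row u" a k] two k by auto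
    thus "\<exists>u. u \<in> I \<and> row u = {a, k}" using u by blast
  qed
  then obtain f where f: "\<And>k. k \<in> colors - {a} \<Longrightarrow> f k \<in> I \<and> row (f k) = {a, k}" by blast
  have "inj_on f (colors - {a})" using f by (intro inj_onI) (metis Diff_iff doubleton_eq_iff)
  hence "card (colors - {a}) \<le> card I" using f by (intro card_inj_on_le[OF _ _ finite_I]) auto
  hence n: "card colors \<le> card I + 1" using card_Diff1_le[of colors a] card_Diff_singleton_if[of colors a]
    by (auto split: if_splits)
  define W where "W = (\<lambda>k. {v \<in> I. g (f k) v = a})"
  have "I \<subseteq> W x \<union> W y"
  proof
    fix v assume v: "v \<in> I"
    have "g (f x) v \<in> {a, x}" "g (f y) v \<in> {a, y}" using f xyz row_mem v by blast+
    moreover have "g (f x) v \<in> col v" "g (f y) v \<in> col v" using f xyz col_mem v by auto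
    moreover have "\<not> {a, x, y} \<subseteq> col v"
    proof
      assume "{a, x, y} \<subseteq> col v"
      hence "card {a, x, y} \<le> card (col v)" by (intro card_mono finite_col)
      thus False using two[OF v] xyz by auto
    qed
    ultimately show "v \<in> W x \<union> W y" using a_col v by (auto simp: W_def)
  qed
  hence "card I \<le> card (W x \<union> W y)" by (intro card_mono) (auto simp: W_def finite_I)
  also have "\<dots> \<le> card (W x) + card (W y)" by (rule card_Un_le)
  \<comment> \<open>Here \<open>2 * s\<close> is at most \<open>card (W x) + card (W y) + 1\<close>;
    the extra 1 does no harm, since two cardinalities below \<open>s\<close> would add up to at most
    \<open>2 * s - 2\<close>.\<close>
  finally have "s \<le> card (W x) \<or> s \<le> card (W y)" using s n by linarith
  thus ?thesis using f xyz by (auto simp: has_mono_star_def W_def)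
qed

text \<open>One edge of each color outside the constant row gives a graph without a path on four
  vertices: such a path, prolonged by the constant row, would be a rainbow \<open>P\<^sub>5\<close>. So each
  of its edges has an end of degree one.\<close>

lemma card_colors_if_mono_row:
  assumes z: "z \<in> I" and k: "\<And>v. v \<in> I \<Longrightarrow> g z v = k"
  shows "card colors \<le> 2 * card I"
proof -
  let ?C = "colors - {k}"
  have "\<exists>e. fst e \<in> I - {z} \<and> snd e \<in> I \<and> g (fst e) (snd e) = m" if "m \<in> ?C" for m
  proof -
    obtain u v where "u \<in> I" "v \<in> I" "g u v = m" using \<open>m \<in> ?C\<close> by (auto simp: colors_def row_def)
    thus ?thesis using that k by (intro exI[of _ "(u, v)"]) auto
  qed
  then obtain e where e: "\<And>m. m \<in> ?C \<Longrightarrow> fst (e m) \<in> I - {z} \<and> snd (e m) \<in> I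
      \<and> g (fst (e m)) (snd (e m)) = m" by metis
  have no_P4: "fst (e m) \<noteq> fst (e m') \<or> snd (e m) \<noteq> snd (e m'')"
    if a: "m \<in> ?C" "m' \<in> ?C" "m'' \<in> ?C" "m' \<noteq> m" "m'' \<noteq> m" for m m' m''
  proof (rule ccontr)
    assume "\<not> ?thesis"
    hence eq: "fst (e m) = fst (e m')" "snd (e m) = snd (e m'')" by auto
    note f = e[OF a(1)] e[OF a(2)] e[OF a(3)]
    have "m' \<noteq> m''" using f(2,3) eq a(5) f(1) by metis
    have "fst (e m') \<noteq> fst (e m'')" using f(1,3) eq a(5) by metis
    have "snd (e m') \<noteq> snd (e m'')" using f(1,2) eq a(4) by metis
    have "g (fst (e m')) (snd (e m'')) = m" using f(1) eq by metis
    moreover have "g z (snd (e m')) = k" using k f(2) by blast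
    moreover note f \<open>m' \<noteq> m''\<close> \<open>fst (e m') \<noteq> fst (e m'')\<close> \<open>snd (e m') \<noteq> snd (e m'')\<close>
    ultimately show False
      using row_path[of z "fst (e m')" "fst (e m'')" "snd (e m')" "snd (e m'')"] a z by auto
  qed
  \<comment> \<open>\<open>h m\<close> is an end of the edge chosen for \<open>m\<close> that lies
    on no other chosen edge: if the left end is shared, \<open>no_P4\<close> says that the right end
    is not.\<close>
  define h where "h = (\<lambda>m. if \<exists>m'\<in>?C. m' \<noteq> m \<and> fst (e m') = fst (e m)
    then Inr (snd (e m)) else Inl (fst (e m)))"
  have "inj_on h ?C"
  proof (rule inj_onI, rule ccontr)
    fix m m' assume a: "m \<in> ?C" "m' \<in> ?C" "h m = h m'" "m \<noteq> m'"
    show False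
      using a(3) no_P4[OF a(1) _ a(2)] a by (auto simp: h_def split: if_splits) metis+
  qed
  moreover have "h ` ?C \<subseteq> (I - {z}) <+> I" using e by (auto simp: h_def)
  ultimately have "card ?C \<le> card ((I - {z}) <+> I)"
    using finite_I by (intro card_inj_on_le) auto
  also have "\<dots> = card I - 1 + card I" using finite_I z by (simp add: card_Plus)
  finally have "card ?C \<le> card I - 1 + card I" .
  moreover have "card I > 0" using finite_I z by (auto simp: card_gt_0_iff)
  ultimately show ?thesis using card_Diff_singleton_if[of colors k] by (auto split: if_splits)
qed

text \<open>The constant row is itself a star with \<open>card I\<close> edges, and there are at
  most \<open>2 * card I\<close> colors.\<close>

lemma star_if_mono_row:
  assumes s: "2 * s \<le> card colors" and z: "z \<in> I" "card (row z) \<le> 1"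
  shows "has_mono_star s"
proof -
  have k: "g z v = g z z" if "v \<in> I" for v
    using card_le_Suc0_iff_eq[of "row z"] finite_row row_mem z that by auto
  have "{v \<in> I. g z v = g z z} = I" using k by blast
  moreover have "s \<le> card I" using card_colors_if_mono_row[OF z(1) k] s by simp
  ultimately have "s \<le> card {v \<in> I. g z v = g z z}" by simp
  thus ?thesis using z(1) unfolding has_mono_star_def by blast
qed

lemma transpose_star: "rainbow_P5_free.has_mono_star I (\<lambda>x y. g y x) = has_mono_star"
  by (auto simp: fun_eq_iff rainbow_P5_free.has_mono_star_def[OF transpose] has_mono_star_def)

lemmas star_if_mono_col =
  rainbow_P5_free.star_if_mono_row[OF transpose, unfolded transpose_row transpose_colors transpose_star]

lemmas mono_row_or_col_if_col_large =
  rainbow_P5_free.mono_row_or_col_if_row_large[OF transpose, unfolded transpose_row transpose_col]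

lemmas col_le_2 =
  rainbow_P5_free.row_le_2[OF transpose, unfolded transpose_row transpose_col transpose_colors]

text \<open>If no vertex sees only one color, then each sees at most four, therefore at most two,
  therefore exactly two.\<close>

theorem star_if_many_colors:
  assumes many: "card colors \<ge> 8" and s: "2 * s \<le> card colors"
  shows "has_mono_star s"
proof (cases "\<exists>z\<in>I. card (row z) \<le> 1 \<or> card (col z) \<le> 1")
  case True
  thus ?thesis using star_if_mono_row[OF s] star_if_mono_col[OF s] by blast
next
  case False
  hence nonmono: "2 \<le> card (row z) \<and> 2 \<le> card (col z)" if "z \<in> I" for z
    using that by (metis Suc_1 not_less_eq_eq One_nat_def)
  have small: "card (row z) \<le> 4 \<and> card (col z) \<le> 4" if "z \<in> I" for z
    using mono_row_or_col_if_row_large[OF that] mono_row_or_col_if_col_large[OF that] False by fastforce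
  have "card (row z) = 2 \<and> card (col z) = 2" if "z \<in> I" for z
    using row_le_2[OF many nonmono small that] col_le_2[OF many _ _ that] nonmono small that
    by (meson le_antisym)
  thus ?thesis using star_if_all_two[OF many _ s] by blast
qed

end

section \<open>Counting paths on five vertices\<close>

text \<open>The pair \<open>(i, j)\<close> encodes the edge between vertex \<open>i\<close> of the left and vertex
  \<open>j\<close> of the right side. A zigzag is the edge set of a \<open>P\<^sub>5\<close> with three vertices on the left
  side; requiring \<open>x < y\<close> selects one of the two directions in which such a path can be
  traversed.\<close>

fun zigzag :: "('v \<times> 'v \<times> 'v) \<times> ('v \<times> 'v) \<Rightarrow> ('v \<times> 'v) set" where
  "zigzag ((a, b, c), (y, x)) = {(a, x), (b, x), (b, y), (c, y)}"

definition triples :: "nat \<Rightarrow> (nat \<times> nat \<times> nat) set" where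
  "triples n = (SIGMA a:{..<n}. SIGMA b:{..<n} - {a}. {..<n} - {a, b})"

definition pairs :: "nat \<Rightarrow> (nat \<times> nat) set" where
  "pairs n = (SIGMA y:{..<n}. {..<y})"

definition row_zigzags :: "nat \<Rightarrow> (nat \<times> nat) set set" where
  "row_zigzags n = zigzag ` (triples n \<times> pairs n)"

definition zigzags :: "nat \<Rightarrow> (nat \<times> nat) set set" where
  "zigzags n = row_zigzags n \<union> (`) prod.swap ` row_zigzags n"

lemma mem_triples [simp]:
  "(a, b, c) \<in> triples n \<longleftrightarrow> a < n \<and> b < n \<and> c < n \<and> a \<noteq> b \<and> b \<noteq> c \<and> a \<noteq> c"
  by (auto simp: triples_def)

lemma mem_pairs [simp]: "(y, x) \<in> pairs n \<longleftrightarrow> x < y \<and> y < n"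
  by (auto simp: pairs_def)

lemma finite_triples: "finite (triples n)" and finite_pairs: "finite (pairs n)"
  by (simp_all add: triples_def pairs_def)

lemma card_triples: "card (triples n) = n * ((n - 1) * (n - 2))"
proof -
  have "card (SIGMA b:{..<n} - {a}. {..<n} - {a, b}) = (n - 1) * (n - 2)" if "a < n" for a
  proof -
    have "card ({..<n} - {a, b}) = n - 2" if "b \<in> {..<n} - {a}" for b
      using that \<open>a < n\<close> by (subst card_Diff_subset) auto
    thus ?thesis using that by (simp add: card_Diff_singleton)
  qed
  thus ?thesis by (simp add: triples_def numeral_2_eq_2)
qed

lemma card_pairs: "2 * card (pairs n) = n * (n - 1)"
proof -
  have "2 * card (pairs n) = 2 * \<Sum>{..<n}" by (simp add: pairs_def)
  also have "\<dots> = n * (n - 1)"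
  proof (induction n)
    case (Suc n)
    thus ?case by (cases n) (auto simp: lessThan_Suc)
  qed simp
  finally show ?thesis .
qed

text \<open>The columns that occur give \<open>x\<close> and \<open>y\<close> in increasing order.
  The entries in them give \<open>{a, b}\<close> and \<open>{b, c}\<close>, whose common element is
  \<open>b\<close>.\<close>

lemma inj_on_zigzag: "inj_on zigzag (triples n \<times> pairs n)"
proof (rule inj_onI)
  fix p q assume "p \<in> triples n \<times> pairs n" "q \<in> triples n \<times> pairs n" and eq: "zigzag p = zigzag q"
  then obtain a b c x y a' b' c' x' y' where p: "p = ((a, b, c), (y, x))" "q = ((a', b', c'), (y', x'))"
    and d: "a \<noteq> b" "b \<noteq> c" "a \<noteq> c" "x < y" "a' \<noteq> b'" "b' \<noteq> c'" "a' \<noteq> c'" "x' < y'"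
    by (cases p; cases q) auto
  have "snd ` zigzag p = snd ` zigzag q" using eq by simp
  hence "{x, y} = {x', y'}" using p by auto
  hence xy: "x = x'" "y = y'" using d by (auto simp: doubleton_eq_iff)
  have "{i. (i, x) \<in> zigzag p} = {a, b}" "{i. (i, x) \<in> zigzag q} = {a', b'}"
    "{i. (i, y) \<in> zigzag p} = {b, c}" "{i. (i, y) \<in> zigzag q} = {b', c'}"
    using p d xy by auto
  hence "{a, b} = {a', b'}" "{b, c} = {b', c'}" using eq by auto
  thus "p = q" using p d xy by (auto simp: doubleton_eq_iff)
qed

lemma finite_row_zigzags: "finite (row_zigzags n)"
  by (simp add: row_zigzags_def finite_triples finite_pairs)

lemma finite_zigzags: "finite (zigzags n)"
  by (simp add: zigzags_def finite_row_zigzags)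

text \<open>If \<open>x > y\<close>, the path is read from its other end.\<close>

lemma zigzag_in_row_zigzags:
  assumes "a < n" "b < n" "c < n" "x < n" "y < n" "a \<noteq> b" "b \<noteq> c" "a \<noteq> c" "x \<noteq> y"
  shows "{(a, x), (b, x), (b, y), (c, y)} \<in> row_zigzags n"
proof (cases "x < y")
  case True
  have "{(a, x), (b, x), (b, y), (c, y)} = zigzag ((a, b, c), (y, x))" by simp
  thus ?thesis using assms True unfolding row_zigzags_def
    by (intro image_eqI[of _ _ "((a, b, c), (y, x))"]) auto
next
  case False
  have "{(a, x), (b, x), (b, y), (c, y)} = zigzag ((c, b, a), (x, y))" by auto
  thus ?thesis using assms False unfolding row_zigzags_def
    by (intro image_eqI[of _ _ "((c, b, a), (x, y))"]) auto
qed

lemma row_zigzagsE: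
  assumes "F \<in> row_zigzags n"
  obtains a b c x y where "F = {(a, x), (b, x), (b, y), (c, y)}"
    "a < n" "b < n" "c < n" "x < n" "y < n" "a \<noteq> b" "b \<noteq> c" "a \<noteq> c" "x \<noteq> y"
  using assms by (fastforce simp: row_zigzags_def)

lemma swap_swap_image: "prod.swap ` prod.swap ` F = F"
  by (simp add: image_image)

lemma inj_swap_image: "inj ((`) prod.swap)"
  by (metis injI swap_swap_image)

text \<open>A path with three left vertices has two right vertices, and after the swap
  three.\<close>

lemma row_zigzags_disjoint_swap: "row_zigzags n \<inter> (`) prod.swap ` row_zigzags n = {}"
proof -
  have "card (snd ` F) = 2 \<and> card (snd ` prod.swap ` F) = 3" if "F \<in> row_zigzags n" for F
    using that by (elim row_zigzagsE) simp
  note card = this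
  have "F \<noteq> prod.swap ` F'" if "F \<in> row_zigzags n" "F' \<in> row_zigzags n" for F F'
  proof
    assume "F = prod.swap ` F'"
    thus False using card[OF that(1)] card[OF that(2)] by simp
  qed
  thus ?thesis by blast
qed

text \<open>Both choices of the side with three vertices contribute equally, and this factor 2
  cancels the one in \<open>card_pairs\<close>.\<close>

lemma card_zigzags: "card (zigzags n) = n\<^sup>2 * (n - 1)\<^sup>2 * (n - 2)"
proof -
  have "card (zigzags n) = card (row_zigzags n) + card (row_zigzags n)"
    unfolding zigzags_def
    by (simp add: card_Un_disjoint finite_row_zigzags row_zigzags_disjoint_swap
        card_image inj_on_subset[OF inj_swap_image])
  also have "\<dots> = 2 * (card (triples n) * card (pairs n))"
    by (simp add: row_zigzags_def card_image inj_on_zigzag card_cartesian_product)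
  also have "\<dots> = card (triples n) * (2 * card (pairs n))" by simp
  also have "\<dots> = card (triples n) * (n * (n - 1))" by (simp only: card_pairs)
  finally show ?thesis by (simp add: card_triples power2_eq_square)
qed

section \<open>Paths through two given edges\<close>

definition row_through :: "nat \<Rightarrow> nat \<times> nat \<Rightarrow> nat \<times> nat \<Rightarrow> (nat \<times> nat) set set" where
  "row_through n e f = {F \<in> row_zigzags n. e \<in> F \<and> f \<in> F}"

definition through :: "nat \<Rightarrow> nat \<times> nat \<Rightarrow> nat \<times> nat \<Rightarrow> (nat \<times> nat) set set" where
  "through n e f = {F \<in> zigzags n. e \<in> F \<and> f \<in> F}"

lemma finite_row_through: "finite (row_through n e f)"
  by (simp add: row_through_def finite_row_zigzags)

lemma card_through:
  "card (through n e f) = card (row_through n e f) + card (row_through n (prod.swap e) (prod.swap f))"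
proof -
  let ?R = "row_through n (prod.swap e) (prod.swap f)"
  have mem: "e \<in> prod.swap ` F \<longleftrightarrow> prod.swap e \<in> F" for e :: "nat \<times> nat" and F
    by (cases e) force
  have "through n e f = row_through n e f \<union> (`) prod.swap ` ?R"
    by (auto simp: through_def row_through_def zigzags_def mem)
  moreover have "row_through n e f \<inter> (`) prod.swap ` ?R = {}"
    using row_zigzags_disjoint_swap[of n] by (auto simp: row_through_def)
  ultimately show ?thesis
    by (simp add: card_Un_disjoint finite_row_through card_image inj_on_subset[OF inj_swap_image])
qed

text \<open>The common left vertex \<open>u\<close> must be the middle of the path. What remains is
  an ordered choice of the two ends.\<close>

lemma row_through_same_row:
  assumes "u < n" "v < n" "v' < n" "v \<noteq> v'"
  shows "card (row_through n (u, v) (u, v')) \<le> (n - 1) * (n - 2)"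
proof -
  let ?P = "SIGMA a:{..<n} - {u}. {..<n} - {u, a}"
  let ?h = "\<lambda>(a, c). {(a, v), (u, v), (u, v'), (c, v')}"
  have "row_through n (u, v) (u, v') \<subseteq> ?h ` ?P"
  proof
    fix F assume "F \<in> row_through n (u, v) (u, v')"
    hence F: "F \<in> row_zigzags n" "(u, v) \<in> F" "(u, v') \<in> F" by (auto simp: row_through_def)
    from F(1) show "F \<in> ?h ` ?P"
    proof (cases rule: row_zigzagsE)
      case (1 a b c x y)
      have "b = u \<and> (x = v \<and> y = v' \<or> x = v' \<and> y = v)" using F 1 assms by auto
      thus ?thesis
      proof (elim conjE disjE)
        assume "b = u" "x = v" "y = v'"
        thus ?thesis using 1 by (intro image_eqI[of _ _ "(a, c)"]) auto
      next
        assume "b = u" "x = v'" "y = v"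
        thus ?thesis using 1 by (intro image_eqI[of _ _ "(c, a)"]) auto
      qed
    qed
  qed
  hence "card (row_through n (u, v) (u, v')) \<le> card (?h ` ?P)" by (rule card_mono[rotated]) simp
  also have "\<dots> \<le> card ?P" by (rule card_image_le) simp
  also have "\<dots> = (\<Sum>a\<in>{..<n} - {u}. n - 2)"
    by (subst card_SigmaI) (use assms in \<open>auto intro!: sum.cong simp: card_Diff_subset\<close>)
  also have "\<dots> = (n - 1) * (n - 2)" using assms by simp
  finally show ?thesis .
qed

text \<open>One of \<open>u\<close> and \<open>u'\<close> is the middle and the other an end, which
  gives the factor 2. The second column and the other end are free.\<close>

lemma row_through_same_col:
  assumes "u < n" "u' < n" "v < n" "u \<noteq> u'"
  shows "card (row_through n (u, v) (u', v)) \<le> 2 * ((n - 1) * (n - 2))"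
proof -
  let ?P = "({..<n} - {v}) \<times> ({..<n} - {u, u'})"
  let ?h = "\<lambda>u u' (y, c). {(u, v), (u', v), (u', y), (c, y)}"
  have "row_through n (u, v) (u', v) \<subseteq> ?h u u' ` ?P \<union> ?h u' u ` ?P"
  proof
    fix F assume "F \<in> row_through n (u, v) (u', v)"
    hence F: "F \<in> row_zigzags n" "(u, v) \<in> F" "(u', v) \<in> F" by (auto simp: row_through_def)
    from F(1) show "F \<in> ?h u u' ` ?P \<union> ?h u' u ` ?P"
    proof (cases rule: row_zigzagsE)
      case (1 a b c x y)
      have "x = v \<and> a = u \<and> b = u' \<or> x = v \<and> a = u' \<and> b = u \<or>
        y = v \<and> c = u \<and> b = u' \<or> y = v \<and> c = u' \<and> b = u"
        using F 1 assms by auto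
      thus ?thesis
      proof (elim conjE disjE)
        assume "x = v" "a = u" "b = u'"
        thus ?thesis using 1 by (intro UnI1 image_eqI[of _ _ "(y, c)"]) auto
      next
        assume "x = v" "a = u'" "b = u"
        thus ?thesis using 1 by (intro UnI2 image_eqI[of _ _ "(y, c)"]) auto
      next
        assume "y = v" "c = u" "b = u'"
        thus ?thesis using 1 by (intro UnI1 image_eqI[of _ _ "(x, a)"]) auto
      next
        assume "y = v" "c = u'" "b = u"
        thus ?thesis using 1 by (intro UnI2 image_eqI[of _ _ "(x, a)"]) auto
      qed
    qed
  qed
  hence "card (row_through n (u, v) (u', v)) \<le> card (?h u u' ` ?P \<union> ?h u' u ` ?P)"
    by (rule card_mono[rotated]) simp
  also have "\<dots> \<le> card (?h u u' ` ?P) + card (?h u' u ` ?P)" by (rule card_Un_le)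
  also have "\<dots> \<le> card ?P + card ?P" by (intro add_mono card_image_le) simp_all
  also have "card ?P = (n - 1) * (n - 2)"
    using assms by (simp add: card_cartesian_product card_Diff_subset)
  finally show ?thesis by simp
qed

text \<open>The columns are \<open>v\<close> and \<open>v'\<close>. Of the three left vertices only
  one is free, and the order of the path leaves it three positions.\<close>

lemma row_through_disjoint:
  assumes "u < n" "u' < n" "v < n" "v' < n" "u \<noteq> u'" "v \<noteq> v'"
  shows "card (row_through n (u, v) (u', v')) \<le> 3 * (n - 2)"
proof -
  let ?P = "{..<n} - {u, u'}"
  let ?h1 = "\<lambda>c. {(u, v), (u', v), (u', v'), (c, v')}"
  let ?h2 = "\<lambda>b. {(u, v), (b, v), (b, v'), (u', v')}"
  let ?h3 = "\<lambda>a. {(a, v), (u, v), (u, v'), (u', v')}"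
  have "row_through n (u, v) (u', v') \<subseteq> ?h1 ` ?P \<union> ?h2 ` ?P \<union> ?h3 ` ?P"
  proof
    fix F assume "F \<in> row_through n (u, v) (u', v')"
    hence F: "F \<in> row_zigzags n" "(u, v) \<in> F" "(u', v') \<in> F" by (auto simp: row_through_def)
    have main: "F \<in> ?h1 ` ?P \<union> ?h2 ` ?P \<union> ?h3 ` ?P"
      if F: "F = {(a, v), (b, v), (b, v'), (c, v')}" and d: "a < n" "b < n" "c < n" "a \<noteq> b" "b \<noteq> c" "a \<noteq> c"
      and uv: "(u, v) \<in> F" "(u', v') \<in> F" for a b c
    proof -
      have "a = u \<and> b = u' \<or> a = u \<and> c = u' \<or> b = u \<and> c = u'" using F d uv assms by auto
      thus ?thesis
      proof (elim conjE disjE)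
        assume "a = u" "b = u'"
        thus ?thesis using F d by (intro UnI1 image_eqI[of _ _ c]) auto
      next
        assume "a = u" "c = u'"
        thus ?thesis using F d by (intro UnI1[OF UnI2] image_eqI[of _ _ b]) auto
      next
        assume "b = u" "c = u'"
        thus ?thesis using F d by (intro UnI2 image_eqI[of _ _ a]) auto
      qed
    qed
    from F(1) show "F \<in> ?h1 ` ?P \<union> ?h2 ` ?P \<union> ?h3 ` ?P"
    proof (cases rule: row_zigzagsE)
      case (1 a b c x y)
      have "x = v \<and> y = v' \<or> x = v' \<and> y = v" using F 1 assms by auto
      thus ?thesis
      proof (elim conjE disjE)
        assume "x = v" "y = v'"
        thus ?thesis using main[of a b c] 1 F by simp
      next
        assume "x = v'" "y = v"
        moreover from this have "F = {(c, v), (b, v), (b, v'), (a, v')}" using 1 by auto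
        ultimately show ?thesis using main[of c b a] 1 F by simp
      qed
    qed
  qed
  hence "card (row_through n (u, v) (u', v')) \<le> card (?h1 ` ?P \<union> ?h2 ` ?P \<union> ?h3 ` ?P)"
    by (rule card_mono[rotated]) simp
  also have "\<dots> \<le> card (?h1 ` ?P) + card (?h2 ` ?P) + card (?h3 ` ?P)"
    by (meson add_le_mono1 card_Un_le le_trans)
  also have "\<dots> \<le> card ?P + card ?P + card ?P" by (intro add_mono card_image_le) simp_all
  also have "card ?P = n - 2" using assms by (simp add: card_Diff_subset)
  finally show ?thesis by simp
qed

text \<open>Adjacent edges get one share of \<open>(n - 1) * (n - 2)\<close> from one side and two
  from the other. Disjoint edges get \<open>3 * (n - 2)\<close> from each side, which is no more
  because \<open>2 \<le> n - 1\<close>.\<close>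

lemma card_through_le:
  assumes n: "n \<ge> 3" and e: "e \<in> {..<n} \<times> {..<n}" "f \<in> {..<n} \<times> {..<n}" "e \<noteq> f"
  shows "card (through n e f) \<le> 3 * ((n - 1) * (n - 2))"
proof -
  obtain u v u' v' where uv: "e = (u, v)" "f = (u', v')" by fastforce
  have lt: "u < n" "v < n" "u' < n" "v' < n" using e uv by auto
  have card: "card (through n e f) = card (row_through n (u, v) (u', v')) + card (row_through n (v, u) (v', u'))"
    by (simp add: card_through uv)
  show ?thesis
  proof (cases "u = u'")
    case True
    hence "v \<noteq> v'" using e uv by auto
    thus ?thesis
      using row_through_same_row[of u n v v'] row_through_same_col[of v n v' u] lt True card by simp
  next
    case ne: False
    show ?thesis
    proof (cases "v = v'")
      case True
      thus ?thesis
        using row_through_same_row[of v n u u'] row_through_same_col[of u n u' v] lt ne card by simp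
    next
      case False
      have "card (through n e f) \<le> 6 * (n - 2)"
        using row_through_disjoint[of u n u' v v'] row_through_disjoint[of v n v' u u'] lt ne False card
        by simp
      also have "\<dots> = 3 * (2 * (n - 2))" by simp
      also have "\<dots> \<le> 3 * ((n - 1) * (n - 2))" using n by (intro mult_le_mono) auto
      finally show ?thesis .
    qed
  qed
qed

text \<open>For the lower bound, \<open>?A\<close> parametrizes paths with the common vertex in the
  middle, \<open>?B\<close> those with it as second or fourth vertex, counted after the swap.
  Placing the edges at index 0 makes the order condition of \<open>pairs\<close> automatic.\<close>

lemma card_through_adjacent:
  assumes n: "n \<ge> 3"
  shows "card (through n (0, 0) (0, 1)) = 3 * ((n - 1) * (n - 2))"
proof (rule antisym)
  show "card (through n (0, 0) (0, 1)) \<le> 3 * ((n - 1) * (n - 2))"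
    using n by (intro card_through_le) auto
  let ?A = "SIGMA a:{..<n} - {0}. {..<n} - {0, a}"
  let ?i = "\<lambda>(a, c). ((a, 0::nat, c), (1::nat, 0::nat))"
  let ?B = "{(0::nat, 1::nat), (1, 0)} \<times> ({..<n} - {0, 1}) \<times> ({..<n} - {0})"
  let ?j = "\<lambda>((a, b), c, y). ((a, b, c), (y, 0::nat))"
  have i: "?i ` ?A \<subseteq> triples n \<times> pairs n" and j: "?j ` ?B \<subseteq> triples n \<times> pairs n"
    using n by auto
  have "card ?A = (\<Sum>a\<in>{..<n} - {0}. n - 2)"
    by (subst card_SigmaI) (use n in \<open>auto intro!: sum.cong simp: card_Diff_subset\<close>)
  hence "(n - 1) * (n - 2) = card ?A" using n by simp
  also have "\<dots> = card (zigzag ` ?i ` ?A)"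
    by (subst card_image[OF inj_on_subset[OF inj_on_zigzag i]], subst card_image)
      (auto intro!: inj_onI)
  also have "\<dots> \<le> card (row_through n (0, 0) (0, 1))"
    using i by (intro card_mono finite_row_through) (auto simp: row_through_def row_zigzags_def)
  finally have 1: "(n - 1) * (n - 2) \<le> card (row_through n (0, 0) (0, 1))" .
  have "2 * ((n - 1) * (n - 2)) = card ?B"
    using n by (simp add: card_cartesian_product card_Diff_subset numeral_2_eq_2)
  also have "\<dots> = card (zigzag ` ?j ` ?B)"
    by (subst card_image[OF inj_on_subset[OF inj_on_zigzag j]], subst card_image)
      (auto intro!: inj_onI)
  also have "\<dots> \<le> card (row_through n (0, 0) (1, 0))"
    using j by (intro card_mono finite_row_through) (auto simp: row_through_def row_zigzags_def)
  finally show "3 * ((n - 1) * (n - 2)) \<le> card (through n (0, 0) (0, 1))"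
    using 1 by (simp add: card_through)
qed

section \<open>Colorings that repeat exactly one color\<close>

text \<open>Removing \<open>e\<close> or \<open>f\<close> loses no color and leaves as many elements
  as colors, so \<open>c\<close> is injective on what remains. A set missing one of the two lies in
  such a remainder.\<close>

lemma single_collision:
  assumes "finite A" and "card A = card (c ` A) + 1"
  obtains e f where "e \<in> A" "f \<in> A" "e \<noteq> f" "c e = c f"
    "\<forall>F \<subseteq> A. inj_on c F \<longleftrightarrow> \<not> (e \<in> F \<and> f \<in> F)"
proof -
  have "\<not> inj_on c A" using card_image[of c A] assms by auto
  then obtain e f where ef: "e \<in> A" "f \<in> A" "e \<noteq> f" "c e = c f" by (auto simp: inj_on_def)
  have inj: "inj_on c (A - {x})" if "x \<in> A" "y \<in> A" "x \<noteq> y" "c x = c y" for x y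
  proof -
    have "c x \<in> c ` (A - {x})" using that by auto
    hence "c ` (A - {x}) = c ` A" using \<open>x \<in> A\<close> by (metis image_insert insert_Diff insert_absorb)
    hence "card (c ` (A - {x})) = card (A - {x})" using assms \<open>x \<in> A\<close> by simp
    thus ?thesis using assms by (intro eq_card_imp_inj_on) auto
  qed
  have inj_F: "inj_on c F" if F: "F \<subseteq> A" "\<not> (e \<in> F \<and> f \<in> F)" for F
  proof -
    have "F \<subseteq> A - {e} \<or> F \<subseteq> A - {f}" using F by blast
    thus ?thesis using inj[OF ef] inj[OF ef(2,1)] ef(3,4) by (metis inj_on_subset)
  qed
  have "\<forall>F \<subseteq> A. inj_on c F \<longleftrightarrow> \<not> (e \<in> F \<and> f \<in> F)"
  proof (intro allI impI)
    fix F assume "F \<subseteq> A"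
    thus "inj_on c F \<longleftrightarrow> \<not> (e \<in> F \<and> f \<in> F)"
      using inj_F[of F] inj_onD[of c F e f] ef(3,4) by auto
  qed
  thus thesis by (rule that[OF ef])
qed

lemma card_rainbow_zigzags:
  assumes n: "n \<ge> 3" and c: "card (c ` ({..<n} \<times> {..<n})) = n\<^sup>2 - 1"
  obtains e f where "e \<in> {..<n} \<times> {..<n}" "f \<in> {..<n} \<times> {..<n}" "e \<noteq> f" "c e = c f"
    "card {F \<in> zigzags n. inj_on c F} + card (through n e f) = card (zigzags n)"
    "\<forall>F \<subseteq> {..<n} \<times> {..<n}. inj_on c F \<longleftrightarrow> \<not> (e \<in> F \<and> f \<in> F)"
proof -
  let ?A = "{..<n} \<times> {..<n}"
  have "n\<^sup>2 \<ge> 1" using n by simp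
  hence "card ?A = card (c ` ?A) + 1" unfolding c by (simp add: card_cartesian_product power2_eq_square)
  then obtain e f
    where ef: "e \<in> ?A" "f \<in> ?A" "e \<noteq> f" "c e = c f"
      and iff: "\<forall>F \<subseteq> ?A. inj_on c F \<longleftrightarrow> \<not> (e \<in> F \<and> f \<in> F)"
    by (rule single_collision[OF finite_cartesian_product[OF finite_lessThan finite_lessThan]]) (rule that)
  have sub: "F \<subseteq> ?A" if "F \<in> zigzags n" for F
    using that by (auto simp: zigzags_def elim!: row_zigzagsE)
  have "zigzags n = {F \<in> zigzags n. inj_on c F} \<union> through n e f"
    using iff sub unfolding through_def by blast
  moreover have "{F \<in> zigzags n. inj_on c F} \<inter> through n e f = {}"
    using iff sub unfolding through_def by blast
  ultimately have "card {F \<in> zigzags n. inj_on c F} + card (through n e f) = card (zigzags n)"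
    by (metis card_Un_disjoint finite_Un finite_zigzags)
  thus thesis by (rule that[OF ef _ iff])
qed

section \<open>Copies of graphs in complete bipartite graphs\<close>

definition map_graph :: "('a \<Rightarrow> 'b) \<Rightarrow> 'a graph \<Rightarrow> 'b graph" where
  "map_graph f G = (f ` verts G, (`) f ` edges G)"

lemma simple_graph_map_graph:
  assumes "simple_graph F" and "inj_on f (verts F)"
  shows "simple_graph (map_graph f F)"
proof -
  have "card (f ` e) = 2" if "e \<in> edges F" for e
    using that assms card_image[OF inj_on_subset[OF assms(2)]] by (auto simp: simple_graph_def)
  thus ?thesis using assms(1) by (fastforce simp: simple_graph_def map_graph_def)
qed

lemma edge_eq_doubleton:
  assumes "simple_graph F" and "e \<in> edges F"
  obtains u v where "e = {u, v}" "u \<in> verts F" "v \<in> verts F"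
proof -
  have "card e = 2" "e \<subseteq> verts F" using assms by (auto simp: simple_graph_def)
  thus thesis using that by (auto simp: card_2_iff)
qed

lemma isomorphic_map_graph:
  assumes F: "simple_graph F" and inj: "inj_on f (verts F)"
  shows "isomorphic F (map_graph f F)"
proof -
  have "{u, v} \<in> edges F" if "u \<in> verts F" "v \<in> verts F" "f ` {u, v} \<in> (`) f ` edges F" for u v
  proof -
    obtain e where e: "e \<in> edges F" "f ` {u, v} = f ` e" using \<open>f ` {u, v} \<in> (`) f ` edges F\<close> by blast
    have "e \<subseteq> verts F" using e F by (auto simp: simple_graph_def)
    hence "{u, v} = e" using inj_on_image_eq_iff[OF inj, of "{u, v}" e] e that by simp
    thus ?thesis using e by simp
  qed
  moreover have "{f u, f v} \<in> (`) f ` edges F" if "{u, v} \<in> edges F" for u v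
    using imageI[OF that, of "(`) f"] by simp
  ultimately show ?thesis
    using inj unfolding isomorphic_def map_graph_def
    by (intro exI[of _ f]) (auto simp: bij_betw_def)
qed

text \<open>The definition of \<open>isomorphic\<close> speaks only of pairs of vertices. In simple
  graphs every edge is such a pair, so the edge sets correspond.\<close>

lemma isomorphicE:
  assumes F: "simple_graph F" and S: "simple_graph S" and iso: "isomorphic F S"
  obtains f where "inj_on f (verts F)" "S = map_graph f F"
proof -
  obtain f where f: "bij_betw f (verts F) (verts S)"
    "\<And>u v. u \<in> verts F \<Longrightarrow> v \<in> verts F \<Longrightarrow> {u, v} \<in> edges F \<longleftrightarrow> {f u, f v} \<in> edges S"
    using iso by (auto simp: isomorphic_def)
  have im: "f ` verts F = verts S" using f(1) by (simp add: bij_betw_def)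
  have "edges S = (`) f ` edges F"
  proof (intro equalityI subsetI)
    fix e assume e: "e \<in> edges S"
    then obtain p q where pq: "e = {p, q}" "p \<in> verts S" "q \<in> verts S"
      using edge_eq_doubleton[OF S] by blast
    then obtain u v where uv: "u \<in> verts F" "v \<in> verts F" "p = f u" "q = f v"
      using im by blast
    hence "{u, v} \<in> edges F" using f(2) e pq by simp
    moreover have "e = f ` {u, v}" using pq uv by simp
    ultimately show "e \<in> (`) f ` edges F" by blast
  next
    fix e assume "e \<in> (`) f ` edges F"
    then obtain e' where e': "e' \<in> edges F" "e = f ` e'" by blast
    then obtain u v where "e' = {u, v}" "u \<in> verts F" "v \<in> verts F"
      using edge_eq_doubleton[OF F] by blast
    thus "e \<in> edges S" using e' f(2) by simp
  qed
  hence "S = map_graph f F" using im by (simp add: map_graph_def prod_eq_iff)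
  thus thesis using that f(1) by (auto simp: bij_betw_def)
qed

text \<open>This trades isomorphisms for injective maps of \<open>F\<close> into \<open>G\<close>,
  which are easier to construct and compose.\<close>

lemma mem_copies_iff:
  assumes F: "simple_graph F"
  shows "S \<in> copies F G \<longleftrightarrow> (\<exists>f. S = map_graph f F \<and> inj_on f (verts F)
    \<and> f ` verts F \<subseteq> verts G \<and> (`) f ` edges F \<subseteq> edges G)"
proof
  assume "S \<in> copies F G"
  hence S: "simple_graph S" "verts S \<subseteq> verts G" "edges S \<subseteq> edges G" "isomorphic F S"
    by (auto simp: copies_def subgraph_def)
  from isomorphicE[OF F S(1,4)] obtain f where "inj_on f (verts F)" "S = map_graph f F" .
  thus "\<exists>f. S = map_graph f F \<and> inj_on f (verts F)
    \<and> f ` verts F \<subseteq> verts G \<and> (`) f ` edges F \<subseteq> edges G"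
    using S by (intro exI[of _ f]) (auto simp: map_graph_def)
next
  assume "\<exists>f. S = map_graph f F \<and> inj_on f (verts F)
    \<and> f ` verts F \<subseteq> verts G \<and> (`) f ` edges F \<subseteq> edges G"
  then obtain f where f: "S = map_graph f F" "inj_on f (verts F)"
    "f ` verts F \<subseteq> verts G" "(`) f ` edges F \<subseteq> edges G" by blast
  thus "S \<in> copies F G"
    using simple_graph_map_graph[OF F f(2)] isomorphic_map_graph[OF F f(2)]
    by (simp add: copies_def subgraph_def map_graph_def)
qed

lemma card_edges_map_graph:
  assumes F: "simple_graph F" and inj: "inj_on f (verts F)"
  shows "card (edges (map_graph f F)) = card (edges F)"
proof -
  have "inj_on ((`) f) (edges F)"
  proof (rule inj_onI)
    fix e e' assume "e \<in> edges F" "e' \<in> edges F" "f ` e = f ` e'"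
    moreover from this have "e \<subseteq> verts F" "e' \<subseteq> verts F" using F by (auto simp: simple_graph_def)
    ultimately show "e = e'" using inj_on_image_eq_iff[OF inj] by blast
  qed
  thus ?thesis by (simp add: map_graph_def card_image)
qed

section \<open>Copies of the path as sets of pairs\<close>

fun edge :: "nat \<times> nat \<Rightarrow> (nat + nat) set" where
  "edge (i, j) = {Inl i, Inr j}"

lemma inj_edge: "inj edge"
proof (rule injI)
  fix p q assume "edge p = edge q"
  thus "p = q" by (cases p; cases q) (simp add: doubleton_eq_iff)
qed

lemma edges_complete_bipartite:
  "edges (complete_bipartite m n) = edge ` ({..<m} \<times> {..<n})"
proof -
  have "edge ` ({..<m} \<times> {..<n}) = {edge (i, j) | i j. i < m \<and> j < n}" by blast
  thus ?thesis by (simp add: complete_bipartite_def)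
qed

lemma edges_path_graph_5:
  "edges (path_graph 5) = {{0, 1}, {1, 2}, {2, 3}, {3, 4}}"
proof -
  have "{i. Suc i < 5} = {0, 1, 2, 3}" by auto
  moreover have "edges (path_graph 5) = (\<lambda>i. {i, Suc i}) ` {i. Suc i < 5}"
    by (auto simp: path_graph_def)
  ultimately show ?thesis by (simp add: numeral_eq_Suc)
qed

lemma verts_path_graph_5: "verts (path_graph 5) = {0, 1, 2, 3, 4}"
  by (auto simp: path_graph_def)

lemma simple_graph_path_graph_5: "simple_graph (path_graph 5)"
  unfolding simple_graph_def verts_path_graph_5 edges_path_graph_5 by simp

text \<open>A graph without isolated vertices is determined by its edges, so copies can be counted
  as sets of pairs.\<close>

definition graph_of :: "(nat \<times> nat) set \<Rightarrow> (nat + nat) graph" where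
  "graph_of F = (\<Union> (edge ` F), edge ` F)"

lemma inj_graph_of: "inj graph_of"
  by (rule injI) (simp add: graph_of_def inj_image_eq_iff[OF inj_edge])

lemma map_graph_path_graph_5:
  "map_graph f (path_graph 5) =
    ({f 0, f 1, f 2, f 3, f 4}, {{f 0, f 1}, {f 1, f 2}, {f 2, f 3}, {f 3, f 4}})"
  unfolding map_graph_def verts_path_graph_5 edges_path_graph_5 by simp

lemma edge_iff:
  "{Inl i, Inr j} \<in> edges (complete_bipartite n n) \<longleftrightarrow> i < n \<and> j < n"
  "{Inr j, Inl i} \<in> edges (complete_bipartite n n) \<longleftrightarrow> i < n \<and> j < n"
  "{Inl i, Inl i'} \<notin> edges (complete_bipartite n n)"
  "{Inr j, Inr j'} \<notin> edges (complete_bipartite n n)"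
  by (auto simp: complete_bipartite_def doubleton_eq_iff)

text \<open>The vertices of a path alternate between the sides. The side of \<open>f 0\<close>
  decides between a row zigzag and a swapped one.\<close>

lemma copies_path_graph_5:
  "copies (path_graph 5) (complete_bipartite n n) = graph_of ` zigzags n"
proof (intro equalityI subsetI)
  fix S assume "S \<in> copies (path_graph 5) (complete_bipartite n n)"
  then obtain f where S: "S = map_graph f (path_graph 5)"
    and inj: "inj_on f {0, 1, 2, 3, 4}"
    and e: "{f 0, f 1} \<in> edges (complete_bipartite n n)" "{f 1, f 2} \<in> edges (complete_bipartite n n)"
      "{f 2, f 3} \<in> edges (complete_bipartite n n)" "{f 3, f 4} \<in> edges (complete_bipartite n n)"
    unfolding mem_copies_iff[OF simple_graph_path_graph_5] verts_path_graph_5 edges_path_graph_5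
    by auto
  have ne: "f 0 \<noteq> f 2" "f 2 \<noteq> f 4" "f 0 \<noteq> f 4" "f 1 \<noteq> f 3" using inj by (auto simp: inj_on_def)
  show "S \<in> graph_of ` zigzags n"
  proof (cases "f 0")
    case f0: (Inl a)
    obtain x where f1: "f 1 = Inr x" using e(1) f0 by (cases "f 1") (auto simp: edge_iff)
    obtain b where f2: "f 2 = Inl b" using e(2) f1 by (cases "f 2") (auto simp: edge_iff)
    obtain y where f3: "f 3 = Inr y" using e(3) f2 by (cases "f 3") (auto simp: edge_iff)
    obtain c where f4: "f 4 = Inl c" using e(4) f3 by (cases "f 4") (auto simp: edge_iff)
    note f = f0 f1 f2 f3 f4
    have "{(a, x), (b, x), (b, y), (c, y)} \<in> row_zigzags n"
      using ne e unfolding f by (intro zigzag_in_row_zigzags) (auto simp: edge_iff)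
    moreover have "S = graph_of {(a, x), (b, x), (b, y), (c, y)}"
      unfolding S map_graph_path_graph_5 f graph_of_def by (auto simp: insert_commute)
    ultimately show ?thesis by (auto simp: zigzags_def)
  next
    case f0: (Inr a)
    obtain x where f1: "f 1 = Inl x" using e(1) f0 by (cases "f 1") (auto simp: edge_iff)
    obtain b where f2: "f 2 = Inr b" using e(2) f1 by (cases "f 2") (auto simp: edge_iff)
    obtain y where f3: "f 3 = Inl y" using e(3) f2 by (cases "f 3") (auto simp: edge_iff)
    obtain c where f4: "f 4 = Inr c" using e(4) f3 by (cases "f 4") (auto simp: edge_iff)
    note f = f0 f1 f2 f3 f4
    have "{(a, x), (b, x), (b, y), (c, y)} \<in> row_zigzags n"
      using ne e unfolding f by (intro zigzag_in_row_zigzags) (auto simp: edge_iff)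
    hence "prod.swap ` {(a, x), (b, x), (b, y), (c, y)} \<in> zigzags n"
      unfolding zigzags_def by blast
    moreover have "S = graph_of (prod.swap ` {(a, x), (b, x), (b, y), (c, y)})"
      unfolding S map_graph_path_graph_5 f graph_of_def by (auto simp: insert_commute)
    ultimately show ?thesis by blast
  qed
next
  fix S assume "S \<in> graph_of ` zigzags n"
  then obtain F where F: "F \<in> zigzags n" "S = graph_of F" by blast
  \<comment> \<open>List lookup serves as the embedding of the vertices 0 to 4 of the path.\<close>
  have *: "map_graph ((!) [p, q, r, s, z]) (path_graph 5) \<in> copies (path_graph 5) (complete_bipartite n n)"
    if "distinct [p, q, r, s, z]" "{p, q} \<in> edges (complete_bipartite n n)"
      "{q, r} \<in> edges (complete_bipartite n n)" "{r, s} \<in> edges (complete_bipartite n n)"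
      "{s, z} \<in> edges (complete_bipartite n n)" for p q r s z
  proof -
    have "{p, q, r, s, z} \<subseteq> verts (complete_bipartite n n)"
      using that by (auto simp: complete_bipartite_def doubleton_eq_iff)
    thus ?thesis
      unfolding mem_copies_iff[OF simple_graph_path_graph_5] verts_path_graph_5 edges_path_graph_5
      using that by (intro exI conjI refl) (auto simp: inj_on_def)
  qed
  from F(1) obtain F' where F': "F' \<in> row_zigzags n" "F = F' \<or> F = prod.swap ` F'"
    by (auto simp: zigzags_def)
  from F'(1) show "S \<in> copies (path_graph 5) (complete_bipartite n n)"
  proof (cases rule: row_zigzagsE)
    case (1 a b c x y)
    from F'(2) show ?thesis
    proof
      assume "F = F'"
      hence "S = map_graph ((!) [Inl a, Inr x, Inl b, Inr y, Inl c]) (path_graph 5)"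
        unfolding F map_graph_path_graph_5 1 graph_of_def by (auto simp: insert_commute)
      thus ?thesis using * 1 by (simp add: edge_iff)
    next
      assume "F = prod.swap ` F'"
      hence "S = map_graph ((!) [Inr a, Inl x, Inr b, Inl y, Inr c]) (path_graph 5)"
        unfolding F map_graph_path_graph_5 1 graph_of_def by (auto simp: insert_commute)
      thus ?thesis using * 1 by (simp add: edge_iff)
    qed
  qed
qed

lemma rainbow_copies_path_graph_5:
  "rainbow_copies c (path_graph 5) (complete_bipartite n n) =
    graph_of ` {F \<in> zigzags n. inj_on (c \<circ> edge) F}"
proof -
  have "rainbow c (graph_of F) \<longleftrightarrow> inj_on (c \<circ> edge) F" for F
    using comp_inj_on_iff[OF inj_on_subset[OF inj_edge subset_UNIV], of c F]
    by (simp add: rainbow_def graph_of_def)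
  thus ?thesis by (auto simp: rainbow_copies_def copies_path_graph_5)
qed

lemma card_rainbow_copies_path_graph_5:
  "card (rainbow_copies c (path_graph 5) (complete_bipartite n n)) =
    card {F \<in> zigzags n. inj_on (c \<circ> edge) F}"
  unfolding rainbow_copies_path_graph_5
  by (rule card_image) (rule inj_on_subset[OF inj_graph_of subset_UNIV])

section \<open>Transfer to colorings of the complete bipartite graph\<close>

lemma mono_copy_of_star_subgraph:
  fixes H :: "'a graph"
  assumes H: "simple_graph H" "copies H (complete_bipartite 1 s) \<noteq> {}"
    and z: "z \<in> verts (complete_bipartite n n)"
    and leaf: "inj_on leaf {..<s}"
      "\<And>j. j < s \<Longrightarrow> {z, leaf j} \<in> edges (complete_bipartite n n) \<and> c {z, leaf j} = k"
  shows "mono_copies c H (complete_bipartite n n) \<noteq> {}"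
proof -
  let ?S = "complete_bipartite 1 s" and ?K = "complete_bipartite n n"
  obtain f where f: "inj_on f (verts H)" "f ` verts H \<subseteq> verts ?S" "(`) f ` edges H \<subseteq> edges ?S"
    using H(2) mem_copies_iff[OF H(1)] by (metis ex_in_conv)
  \<comment> \<open>The only left vertex of the star is its center \<open>Inl 0\<close>, so
    \<open>h\<close> can send the whole left type to \<open>z\<close>. Composed with the embedding
    \<open>f\<close> of \<open>H\<close> into the star, it yields the copy.\<close>
  define h where "h = case_sum (\<lambda>_::nat. z) leaf"
  have ne: "leaf j \<noteq> z" "leaf j \<in> verts ?K" if "j < s" for j
    using leaf(2)[OF that] by (auto simp: complete_bipartite_def doubleton_eq_iff)
  have vS: "verts ?S = insert (Inl 0) (Inr ` {..<s})"
    by (auto simp: complete_bipartite_def)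
  have h: "inj_on h (verts ?S)" "h ` verts ?S \<subseteq> verts ?K"
    unfolding vS using ne z leaf(1) by (force simp: h_def inj_on_def)+
  have he: "h ` e \<in> edges ?K \<and> c (h ` e) = k" if "e \<in> edges ?S" for e
    using that leaf(2) by (auto simp: h_def complete_bipartite_def)
  have "map_graph (h \<circ> f) H \<in> copies H ?K"
    unfolding mem_copies_iff[OF H(1)]
  proof (intro exI[of _ "h \<circ> f"] conjI)
    show "inj_on (h \<circ> f) (verts H)" using f h by (meson comp_inj_on inj_on_subset)
    show "(h \<circ> f) ` verts H \<subseteq> verts ?K" using f(2) h(2) by (metis image_comp image_mono subset_trans)
    show "(`) (h \<circ> f) ` edges H \<subseteq> edges ?K"
    proof
      fix e assume "e \<in> (`) (h \<circ> f) ` edges H"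
      then obtain e' where "e' \<in> edges H" "e = h ` f ` e'"
        unfolding image_comp [symmetric] by auto
      thus "e \<in> edges ?K" using f(3) he by blast
    qed
  qed simp
  moreover have "c e = k" if e: "e \<in> edges (map_graph (h \<circ> f) H)" for e
  proof -
    obtain e' where "e' \<in> edges H" "e = h ` f ` e'"
      using e unfolding map_graph_def image_comp [symmetric] by auto
    thus ?thesis using f(3) he by blast
  qed
  ultimately have "map_graph (h \<circ> f) H \<in> mono_copies c H ?K"
    by (simp add: mono_copies_def monochromatic_def)
  thus ?thesis by blast
qed

lemma rainbow_P5_free_coloring:
  assumes "rainbow_copies c (path_graph 5) (complete_bipartite n n) = {}"
  shows "rainbow_P5_free {..<n} (\<lambda>u v. c (edge (u, v)))"
proof -
  have free: "\<not> inj_on (c \<circ> edge) F" if "F \<in> zigzags n" for F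
    using assms that unfolding rainbow_copies_path_graph_5 by blast
  have main: "\<not> distinct [c (edge p), c (edge q), c (edge r), c (edge s)]"
    if "{p, q, r, s} \<in> zigzags n" for p q r s
    using free[OF that] by (auto simp: inj_on_def)
  show ?thesis
  proof
    fix a b c' x y assume "a \<in> {..<n}" "b \<in> {..<n}" "c' \<in> {..<n}" "x \<in> {..<n}" "y \<in> {..<n}"
      "a \<noteq> b" "b \<noteq> c'" "a \<noteq> c'" "x \<noteq> y"
    hence z: "{(a, x), (b, x), (b, y), (c', y)} \<in> row_zigzags n"
      by (intro zigzag_in_row_zigzags) auto
    hence "{(a, x), (b, x), (b, y), (c', y)} \<in> zigzags n" by (simp add: zigzags_def)
    thus "\<not> distinct [c (edge (a, x)), c (edge (b, x)), c (edge (b, y)), c (edge (c', y))]"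
      by (rule main)
    have "prod.swap ` {(a, x), (b, x), (b, y), (c', y)} \<in> zigzags n"
      using z unfolding zigzags_def by blast
    hence "{(x, a), (x, b), (y, b), (y, c')} \<in> zigzags n" by simp
    thus "\<not> distinct [c (edge (x, a)), c (edge (x, b)), c (edge (y, b)), c (edge (y, c'))]"
      by (rule main)
  qed simp
qed

lemma rainbow_path_or_mono_star:
  fixes H :: "'a graph"
  assumes H: "simple_graph H" "copies H (complete_bipartite 1 s) \<noteq> {}"
    and c: "exact_coloring q (complete_bipartite n n) c" and q: "q \<ge> 8" "2 * s \<le> q"
  shows "rainbow_copies c (path_graph 5) (complete_bipartite n n) \<noteq> {} \<or>
    mono_copies c H (complete_bipartite n n) \<noteq> {}"
proof (cases "rainbow_copies c (path_graph 5) (complete_bipartite n n) = {}")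
  case True
  interpret rainbow_P5_free "{..<n}" "\<lambda>u v. c (edge (u, v))"
    by (rule rainbow_P5_free_coloring[OF True])
  have "colors = (c \<circ> edge) ` ({..<n} \<times> {..<n})"
    by (force simp: colors_def row_def simp del: edge.simps)
  also have "\<dots> = c ` edges (complete_bipartite n n)"
    by (simp only: edges_complete_bipartite image_comp)
  finally have "colors = c ` edges (complete_bipartite n n)" .
  hence "card colors = q" using c by (simp add: exact_coloring_def)
  hence "has_mono_star s" using star_if_many_colors q by metis
  then obtain z k where z: "z \<in> {..<n}" and "s \<le> card {v \<in> {..<n}. c (edge (z, v)) = k} \<or>
      s \<le> card {v \<in> {..<n}. c (edge (v, z)) = k}"
    unfolding has_mono_star_def by blast
  thus ?thesis
  proof (elim disjE)
    assume "s \<le> card {v \<in> {..<n}. c (edge (z, v)) = k}"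
    then obtain l where l: "inj_on l {..<s}" "l ` {..<s} \<subseteq> {v \<in> {..<n}. c (edge (z, v)) = k}"
      using card_le_inj[of "{..<s}" "{v \<in> {..<n}. c (edge (z, v)) = k}"] by auto
    have "mono_copies c H (complete_bipartite n n) \<noteq> {}"
    proof (rule mono_copy_of_star_subgraph[OF H])
      show "Inl z \<in> verts (complete_bipartite n n)" using z by (auto simp: complete_bipartite_def)
      show "inj_on (Inr \<circ> l) {..<s}" using l(1) by (simp add: inj_on_def)
      show "{Inl z, (Inr \<circ> l) j} \<in> edges (complete_bipartite n n) \<and> c {Inl z, (Inr \<circ> l) j} = k"
        if "j < s" for j
        using l(2) that z by (auto simp: edge_iff)
    qed
    thus ?thesis ..
  next
    assume "s \<le> card {v \<in> {..<n}. c (edge (v, z)) = k}"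
    then obtain l where l: "inj_on l {..<s}" "l ` {..<s} \<subseteq> {v \<in> {..<n}. c (edge (v, z)) = k}"
      using card_le_inj[of "{..<s}" "{v \<in> {..<n}. c (edge (v, z)) = k}"] by auto
    have "mono_copies c H (complete_bipartite n n) \<noteq> {}"
    proof (rule mono_copy_of_star_subgraph[OF H])
      show "Inr z \<in> verts (complete_bipartite n n)" using z by (auto simp: complete_bipartite_def)
      show "inj_on (Inl \<circ> l) {..<s}" using l(1) by (simp add: inj_on_def)
      show "{Inr z, (Inl \<circ> l) j} \<in> edges (complete_bipartite n n) \<and> c {Inr z, (Inl \<circ> l) j} = k"
        if "j < s" for j
        using l(2) that z by (auto simp: edge_iff insert_commute)
    qed
    thus ?thesis ..
  qed
qed simp

section \<open>The multiplicity\<close>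

text \<open>Only two edges share a color. After removal of one of them, at least two edges of a
  monochromatic copy remain, on which the coloring would be both constant and injective.\<close>

lemma mono_copies_empty:
  assumes H: "simple_graph H" "card (edges H) \<ge> 3" and n: "n \<ge> 3"
    and c: "exact_coloring (n\<^sup>2 - 1) (complete_bipartite n n) c"
  shows "mono_copies c H (complete_bipartite n n) = {}"
proof (rule equals0I)
  let ?K = "complete_bipartite n n"
  fix S assume "S \<in> mono_copies c H ?K"
  hence S: "S \<in> copies H ?K" "\<And>e e'. e \<in> edges S \<Longrightarrow> e' \<in> edges S \<Longrightarrow> c e = c e'"
    unfolding mono_copies_def monochromatic_def by blast+
  obtain f where f: "S = map_graph f H" "inj_on f (verts H)"
    using S(1) unfolding mem_copies_iff[OF H(1)] by blast
  have card_S: "card (edges S) \<ge> 3" using card_edges_map_graph[OF H(1) f(2)] f(1) H(2) by simp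
  have "edges S \<subseteq> edge ` ({..<n} \<times> {..<n})"
    using S(1) by (simp add: copies_def subgraph_def edges_complete_bipartite)
  then obtain F where F: "F \<subseteq> {..<n} \<times> {..<n}" "edges S = edge ` F"
    unfolding subset_image_iff by blast
  have "card F \<ge> 3"
    using card_S F(2) card_image[OF inj_on_subset[OF inj_edge subset_UNIV], of F] by simp
  have im: "(c \<circ> edge) ` ({..<n} \<times> {..<n}) = {1..n\<^sup>2 - 1}"
    using c by (simp only: exact_coloring_def edges_complete_bipartite image_comp)
  have "card ((c \<circ> edge) ` ({..<n} \<times> {..<n})) = n\<^sup>2 - 1" unfolding im by simp
  then obtain e f where "e \<in> {..<n} \<times> {..<n}"
    "f \<in> {..<n} \<times> {..<n}" "e \<noteq> f" "(c \<circ> edge) e = (c \<circ> edge) f"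
    "card {F \<in> zigzags n. inj_on (c \<circ> edge) F} + card (through n e f) = card (zigzags n)"
    and iff: "\<forall>F \<subseteq> {..<n} \<times> {..<n}. inj_on (c \<circ> edge) F \<longleftrightarrow> \<not> (e \<in> F \<and> f \<in> F)"
    by (rule card_rainbow_zigzags[OF n]) (rule that)
  have "inj_on (c \<circ> edge) (F - {e})"
  proof -
    have "F - {e} \<subseteq> {..<n} \<times> {..<n}" using F(1) by blast
    thus ?thesis using iff by simp
  qed
  note inj = this
  have eq: "(c \<circ> edge) p = (c \<circ> edge) q" if "p \<in> F - {e}" "q \<in> F - {e}" for p q
    using S(2)[of "edge p" "edge q"] F(2) that by simp
  have "p = q" if "p \<in> F - {e}" "q \<in> F - {e}" for p q
    by (rule inj_onD[OF inj eq[OF that] that])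
  hence "card (F - {e}) \<le> Suc 0"
    using finite_subset[OF F(1)] by (subst card_le_Suc0_iff_eq) auto
  moreover have "card F - 1 \<le> card (F - {e})"
    using card_Diff_singleton_if[of F e] by simp
  ultimately show False using \<open>card F \<ge> 3\<close> by simp
qed

text \<open>The lower bound comes from the number of edges alone: for \<open>N < t\<close> the graph
  has fewer than \<open>t\<^sup>2 - 1\<close> edges.\<close>

lemma bgr_path_graph_5_star_subgraph:
  fixes H :: "'a graph"
  assumes t: "t \<ge> 3" and H: "simple_graph H" "copies H (complete_bipartite 1 s) \<noteq> {}"
    and s: "2 * s \<le> t\<^sup>2 - 1"
  shows "bgr (t\<^sup>2 - 1) (path_graph 5) H = t"
  unfolding bgr_def
proof (rule Least_equality)
  have "t\<^sup>2 \<ge> 3\<^sup>2" using t by (intro power_mono) auto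
  hence "t\<^sup>2 - 1 \<ge> 8" by simp
  thus "t\<^sup>2 - 1 \<le> t\<^sup>2 \<and> (\<forall>n\<ge>t. \<forall>c. exact_coloring (t\<^sup>2 - 1) (complete_bipartite n n) c \<longrightarrow>
      rainbow_copies c (path_graph 5) (complete_bipartite n n) \<noteq> {} \<or>
      mono_copies c H (complete_bipartite n n) \<noteq> {})"
    using rainbow_path_or_mono_star[OF H _ _ s] by auto
next
  fix N assume "t\<^sup>2 - 1 \<le> N\<^sup>2 \<and> (\<forall>n\<ge>N. \<forall>c. exact_coloring (t\<^sup>2 - 1) (complete_bipartite n n) c \<longrightarrow>
      rainbow_copies c (path_graph 5) (complete_bipartite n n) \<noteq> {} \<or>
      mono_copies c H (complete_bipartite n n) \<noteq> {})"
  hence N: "t\<^sup>2 - 1 \<le> N\<^sup>2" by blast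
  show "t \<le> N"
  proof (rule ccontr)
    assume "\<not> ?thesis"
    then obtain d where d: "t = N + 1 + d" by (metis Suc_eq_plus1 less_iff_Suc_add not_le add_Suc)
    have "t\<^sup>2 - 1 = N\<^sup>2 + 2 * N + 2 * N * d + 2 * d + d\<^sup>2"
      unfolding d by (simp add: power2_eq_square algebra_simps)
    thus False using N t d by simp
  qed
qed

text \<open>This is the extremal coloring: all pairs but \<open>(0, 1)\<close> get distinct colors,
  and \<open>(0, 1)\<close> repeats the color of the adjacent edge \<open>(0, 0)\<close>.\<close>

lemma ex_coloring_with_equal_pair:
  assumes t: "t \<ge> 2"
  obtains c where "exact_coloring (t\<^sup>2 - 1) (complete_bipartite t t) c"
    "c (edge (0, 0)) = c (edge (0, 1))"
proof -
  let ?A = "{..<t} \<times> {..<t}"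
  have A: "(0, 0) \<in> ?A" "(0, 1) \<in> ?A" using t by auto
  have "card (?A - {(0, 1)}) = card {1..t\<^sup>2 - 1}"
    using A by (simp add: card_cartesian_product power2_eq_square)
  then obtain h where h: "bij_betw h (?A - {(0, 1)}) {1..t\<^sup>2 - 1}"
    by (metis finite_same_card_bij finite_Diff finite_cartesian_product finite_lessThan finite_atLeastAtMost)
  define h' where "h' = h((0, 1) := h (0, 0))"
  define c where "c = h' \<circ> inv edge"
  have c: "c (edge p) = h' p" for p by (simp add: c_def inv_f_f[OF inj_edge] del: edge.simps)
  have "?A = insert (0, 1) (?A - {(0, 1)})" using A by blast
  hence "h' ` ?A = insert (h (0, 0)) (h' ` (?A - {(0, 1)}))" by (metis image_insert fun_upd_same h'_def)
  also have "h' ` (?A - {(0, 1)}) = h ` (?A - {(0, 1)})" by (auto simp: h'_def)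
  also have "insert (h (0, 0)) \<dots> = h ` (?A - {(0, 1)})" using A by (intro insert_absorb) auto
  finally have "h' ` ?A = {1..t\<^sup>2 - 1}" using h by (simp add: bij_betw_def)
  hence "exact_coloring (t\<^sup>2 - 1) (complete_bipartite t t) c"
    using c by (simp add: exact_coloring_def edges_complete_bipartite image_image del: edge.simps)
  moreover have "c (edge (0, 0)) = c (edge (0, 1))" unfolding c by (simp add: h'_def)
  ultimately show thesis using that by blast
qed

theorem theorem4p5:
  fixes k t :: nat and H :: "'a graph"
  assumes "k = t\<^sup>2" and "k \<ge> 9"
    and "simple_graph H"
    and "copies H (complete_bipartite 1 (nat \<lceil>(real k - 2) / 2\<rceil>)) \<noteq> {}"
    and "card (edges H) \<ge> 3"
  shows "int (bi_GM (k - 1) (path_graph 5) H) =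
    (int t)\<^sup>2 * (int t - 1)\<^sup>2 * (int t - 2) - 3 * (int t - 1) * (int t - 2)"
proof -
  let ?K = "complete_bipartite t t"
  let ?P = "path_graph 5"
  let ?adj = "3 * ((t - 1) * (t - 2))"
  have t: "t \<ge> 3"
  proof (rule ccontr)
    assume "\<not> ?thesis"
    hence "t\<^sup>2 \<le> 2\<^sup>2" by (intro power_mono) auto
    thus False using assms(1,2) by simp
  qed
  \<comment> \<open>A ceiling exceeds its argument by less than 1. Hence twice the size of the star
    is at most the number \<open>k - 1\<close> of colors.\<close>
  have "real_of_int (2 * \<lceil>(real k - 2) / 2\<rceil>) < real_of_int (int k)"
    using ceiling_correct[of "(real k - 2) / 2"] by (simp add: field_simps)
  hence "2 * \<lceil>(real k - 2) / 2\<rceil> \<le> int k - 1" by linarith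
  hence "2 * nat \<lceil>(real k - 2) / 2\<rceil> \<le> t\<^sup>2 - 1" using assms(1,2) by linarith
  hence bgr: "bgr (t\<^sup>2 - 1) ?P H = t"
    using bgr_path_graph_5_star_subgraph t assms(3,4) by blast
  \<comment> \<open>Every coloring loses exactly the paths through its repeated pair. The middle
    clause identifies this pair for the extremal coloring.\<close>
  have count: "\<exists>e f. e \<in> {..<t} \<times> {..<t} \<and> f \<in> {..<t} \<times> {..<t} \<and> e \<noteq> f
      \<and> (c (edge (0, 0)) = c (edge (0, 1)) \<longrightarrow> {e, f} = {(0, 0), (0, 1)})
      \<and> card (rainbow_copies c ?P ?K) + card (mono_copies c H ?K) + card (through t e f) = card (zigzags t)"
    if c: "exact_coloring (t\<^sup>2 - 1) ?K c" for c
  proof -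
    have im: "(c \<circ> edge) ` ({..<t} \<times> {..<t}) = {1..t\<^sup>2 - 1}"
      using c by (simp only: exact_coloring_def edges_complete_bipartite image_comp)
    have "card ((c \<circ> edge) ` ({..<t} \<times> {..<t})) = t\<^sup>2 - 1" unfolding im by simp
    then obtain e f where ef: "e \<in> {..<t} \<times> {..<t}"
      "f \<in> {..<t} \<times> {..<t}" "e \<noteq> f" "(c \<circ> edge) e = (c \<circ> edge) f"
      "card {F \<in> zigzags t. inj_on (c \<circ> edge) F} + card (through t e f) = card (zigzags t)"
      "\<forall>F \<subseteq> {..<t} \<times> {..<t}. inj_on (c \<circ> edge) F \<longleftrightarrow> \<not> (e \<in> F \<and> f \<in> F)"
      by (rule card_rainbow_zigzags[OF t]) (rule that)
    have "{e, f} = {(0, 0), (0, 1)}" if "c (edge (0, 0)) = c (edge (0, 1))"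
    proof -
      have "\<not> inj_on (c \<circ> edge) {(0, 0), (0, 1)}" using that by simp
      hence "e \<in> {(0, 0), (0, 1)} \<and> f \<in> {(0, 0), (0, 1)}"
        using ef(6)[rule_format, of "{(0, 0), (0, 1)}"] t by auto
      thus ?thesis using ef(3) by auto
    qed
    moreover have "card (mono_copies c H ?K) = 0"
      using mono_copies_empty[OF assms(3,5) t c] by simp
    ultimately show ?thesis
      using ef(1,2,3,5) card_rainbow_copies_path_graph_5[of c t] by (intro exI[of _ e] exI[of _ f]) simp
  qed
  obtain c where c: "exact_coloring (t\<^sup>2 - 1) ?K c" "c (edge (0, 0)) = c (edge (0, 1))"
    using ex_coloring_with_equal_pair[of t] t by auto
  obtain e f where ef: "{e, f} = {(0, 0), (0, 1)}"
    "card (rainbow_copies c ?P ?K) + card (mono_copies c H ?K) + card (through t e f) = card (zigzags t)"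
    using count[OF c(1)] c(2) by blast
  have "through t e f = through t (0, 0) (0, 1)"
    using ef(1) by (auto simp: through_def doubleton_eq_iff)
  hence opt: "card (rainbow_copies c ?P ?K) + card (mono_copies c H ?K) + ?adj = card (zigzags t)"
    using ef(2) card_through_adjacent[OF t] by simp
  \<comment> \<open>Minimizing the multiplicity means maximizing the number of paths through the
    repeated pair, which adjacent edges achieve.\<close>
  have "bi_GM (t\<^sup>2 - 1) ?P H = card (zigzags t) - ?adj"
    unfolding bi_GM_def bgr Let_def
  proof (rule Least_equality)
    show "\<exists>c. exact_coloring (t\<^sup>2 - 1) ?K c \<and>
        card (zigzags t) - ?adj = card (rainbow_copies c ?P ?K) + card (mono_copies c H ?K)"
      using c(1) opt by (intro exI[of _ c]) simp
  next
    fix m assume "\<exists>c. exact_coloring (t\<^sup>2 - 1) ?K c \<and>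
        m = card (rainbow_copies c ?P ?K) + card (mono_copies c H ?K)"
    then obtain c where c: "exact_coloring (t\<^sup>2 - 1) ?K c"
      "m = card (rainbow_copies c ?P ?K) + card (mono_copies c H ?K)" by blast
    obtain e f where "e \<in> {..<t} \<times> {..<t}" "f \<in> {..<t} \<times> {..<t}" "e \<noteq> f"
      "m + card (through t e f) = card (zigzags t)"
      using count[OF c(1)] c(2) by blast
    thus "card (zigzags t) - ?adj \<le> m" using card_through_le[OF t, of e f] by linarith
  qed
  \<comment> \<open>By \<open>opt\<close> the subtraction on naturals is not truncated.\<close>
  hence "int (bi_GM (k - 1) ?P H) = int (card (zigzags t)) - int ?adj"
    using opt assms(1) by simp
  also have "int (card (zigzags t)) = (int t)\<^sup>2 * (int t - 1)\<^sup>2 * (int t - 2)"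
    using t by (simp add: card_zigzags of_nat_diff)
  also have "int ?adj = 3 * (int t - 1) * (int t - 2)" using t by (simp add: of_nat_diff)
  finally show ?thesis .
qed

end
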